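(* Let $d \ge 1$ be an integer and let $0 < p < q \le \infty$. Then there exists a constant $C = C_{d,p,q} > 0$, depending only on $d,p,q$, such that, for all integers $N \ge 1$ and all $\mu \in \mathcal P_q(\mathbb R^d)$, \[ e_{N;d,p}(\mu) \le C\, \mathcal M_q(\mu)^{1/q} \times \begin{cases} \max\{N^{-1/p+1/q},\, N^{-1/d}\} & \text{if } d \ne \frac{pq}{q-p},\\ N^{-1/d} \big(\log(1+N)\big)^{1/d} & \text{if } d = \frac{pq}{q-p}, \end{cases} \] where, when $q = \infty$, the expression $\mathcal M_q(\mu)^{1/q}$ is replaced with $\operatorname{rad}(\mu)$. Moreover, if $q < \infty$ and $d < \frac{pq}{q-p}$, then, for every $\mu \in \mathcal P_q(\mathbb R^d)$, \[ \lim_{N \to \infty} N^{1/p - 1/q}\, e_{N;d,p}(\mu) = 0. \]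
   Context: $\mathcal P(\mathbb R^d)$ is the set of Borel probability measures on $\mathbb R^d$, and $|\cdot|$ is the Euclidean norm. For $0 < p < \infty$, $\mathcal M_p(\mu) := \int_{\mathbb R^d} |x|^p\, \mu(dx)$ and $\mathcal P_p(\mathbb R^d) := \{\mu \in \mathcal P(\mathbb R^d) : \mathcal M_p(\mu) < \infty\}$. Also $\operatorname{rad}(\mu) := \inf\{R > 0 : \operatorname{supp}\mu \subseteq B_R(0)\}$ (where $B_R(0)$ is the ball of radius $R$ centered at the origin) and $\mathcal P_\infty(\mathbb R^d) := \{\mu \in \mathcal P(\mathbb R^d) : \operatorname{rad}(\mu) < \infty\}$. For $0<p<\infty$ and $\mu,\nu \in \mathcal P_p(\mathbb R^d)$, \[ \mathcal W_p(\mu,\nu) := \inf_{\gamma \in \Gamma(\mu,\nu)} \left( \iint_{\mathbb R^d\times\mathbb R^d} |x-y|^p\, \gamma(dx,dy) \right)^{1/p}, \] where $\Gamma(\mu,\nu)$ is the set of probability measures on $\mathbb R^d \times \mathbb R^d$ with first marginal $\mu$ and second marginal $\nu$ (values $p<1$ are allowed, with the same formula). For an integer $N \ge 1$, \[ e_{N;d,p}(\mu) := \inf_{(x_1,\dots,x_N) \in (\mathbb R^d)^N} \mathcal W_p\Big(\mu, \frac1N \sum_{i=1}^N \delta_{x_i}\Big). \] Convention when $q = \infty$: $1/q = 0$ and $\frac{pq}{q-p} = p$. *)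

theory Defs
  imports "HOL-Probability.Probability"
begin

(* The exponent range (0, \<infinity>] is modelled by type ereal; moments, radii and transport costs
   take values in ennreal = [0, \<infinity>], so that a divergent integral is \<infinity> and an
   infimum over an empty set is \<infinity>. *)

definition ennpow :: "ennreal \<Rightarrow> real \<Rightarrow> ennreal"  (* used for exponents a > 0 only *)
  where "ennpow x a = (if x = \<infinity> then \<infinity> else ennreal (enn2real x powr a))"

definition borel_probs :: "'a::topological_space measure set"
  where "borel_probs = {\<mu>. sets \<mu> = sets borel \<and> prob_space \<mu>}"

definition moment :: "real \<Rightarrow> 'a::euclidean_space measure \<Rightarrow> ennreal"
  where "moment p \<mu> = (\<integral>\<^sup>+ x. ennreal (norm x powr p) \<partial>\<mu>)"

definition msupport :: "'a::topological_space measure \<Rightarrow> 'a set"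
  where "msupport \<mu> = {x. \<forall>U. open U \<longrightarrow> x \<in> U \<longrightarrow> emeasure \<mu> U > 0}"

definition rad :: "'a::euclidean_space measure \<Rightarrow> ennreal"
  where "rad \<mu> = (INF R \<in> {R::real. 0 < R \<and> msupport \<mu> \<subseteq> ball 0 R}. ennreal R)"

definition probs_moment :: "ereal \<Rightarrow> 'a::euclidean_space measure set"
  where "probs_moment q = {\<mu> \<in> borel_probs.
     if q = \<infinity> then rad \<mu> < \<infinity> else moment (real_of_ereal q) \<mu> < \<infinity>}"

definition moment_scale :: "ereal \<Rightarrow> 'a::euclidean_space measure \<Rightarrow> ennreal"
  where "moment_scale q \<mu> =
    (if q = \<infinity> then rad \<mu> else ennpow (moment (real_of_ereal q) \<mu>) (1 / real_of_ereal q))"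

definition couplings :: "'a::topological_space measure \<Rightarrow> 'a measure \<Rightarrow> ('a \<times> 'a) measure set"
  where "couplings \<mu> \<nu> = {\<gamma> \<in> borel_probs. distr \<gamma> borel fst = \<mu> \<and> distr \<gamma> borel snd = \<nu>}"

definition wasserstein :: "real \<Rightarrow> 'a::euclidean_space measure \<Rightarrow> 'a measure \<Rightarrow> ennreal"
  where "wasserstein p \<mu> \<nu> =
    (INF \<gamma> \<in> couplings \<mu> \<nu>. ennpow (\<integral>\<^sup>+ (x, y). ennreal (norm (x - y) powr p) \<partial>\<gamma>) (1 / p))"

(* (1/N) \<Sum> \<delta>_{x_i}, where return borel a is the Dirac measure at a *)
definition empirical :: "nat \<Rightarrow> (nat \<Rightarrow> 'a::topological_space) \<Rightarrow> 'a measure"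
  where "empirical N x = measure_of UNIV (sets borel)
    (\<lambda>A. ennreal (1 / real N) * (\<Sum>i = 1..N. emeasure (return borel (x i)) A))"

(* measure_of returns the null measure when its argument is not countably additive; this does not
   happen here. *)
lemma emeasure_empirical:
  assumes "A \<in> sets borel"
  shows "emeasure (empirical N x) A =
    ennreal (1 / real N) * (\<Sum>i = 1..N. emeasure (return borel (x i)) A)"
proof -
  let ?m = "\<lambda>A. ennreal (1 / real N) * (\<Sum>i = 1..N. emeasure (return borel (x i)) A)"
  have "countably_additive (sets borel) ?m"
  proof (rule countably_additiveI)
    fix B :: "nat \<Rightarrow> 'a set"
    assume B: "range B \<subseteq> sets borel" "disjoint_family B"
    have "(\<Sum>j. ?m (B j))
        = ennreal (1 / real N) * (\<Sum>i = 1..N. \<Sum>j. emeasure (return borel (x i)) (B j))"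
      by (simp add: suminf_sum)
    also have "\<dots> = ?m (\<Union>j. B j)"
      using B by (intro arg_cong2[where f = "(*)"] refl sum.cong suminf_emeasure) auto
    finally show "(\<Sum>j. ?m (B j)) = ?m (\<Union>j. B j)" .
  qed
  moreover have "positive (sets borel) ?m"
    by (simp add: positive_def)
  moreover have "sets (empirical N x) = sets borel"
    using sets.sigma_sets_eq[of "borel :: 'a measure"] by (simp add: empirical_def)
  ultimately show ?thesis
    using assms by (intro emeasure_measure_of[OF empirical_def]) auto
qed

lemma empirical_borel_probs: "1 \<le> N \<Longrightarrow> empirical N x \<in> borel_probs"
proof -
  assume N: "1 \<le> N"
  have s: "sets (empirical N x) = sets borel"
    using sets.sigma_sets_eq[of "borel :: 'a measure"] by (simp add: empirical_def)
  have sp: "space (empirical N x) = UNIV"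
    using sets_eq_imp_space_eq[OF s] by simp
  have "emeasure (empirical N x) UNIV = ennreal (1 / real N) * of_nat N"
    by (subst emeasure_empirical) auto
  also have "\<dots> = 1"
    using N by (simp add: ennreal_of_nat_eq_real_of_nat ennreal_mult[symmetric])
  finally show ?thesis
    using s sp by (auto simp: borel_probs_def intro: prob_spaceI)
qed

(* (\<real>^d)^N is represented by all functions nat \<Rightarrow> 'a, of which only the values at 1..N matter. *)
definition quant_error :: "nat \<Rightarrow> real \<Rightarrow> 'a::euclidean_space measure \<Rightarrow> ennreal"
  where "quant_error N p \<mu> = (INF x \<in> (UNIV :: (nat \<Rightarrow> 'a) set). wasserstein p \<mu> (empirical N x))"

(* The values of 1/q and pq/(q-p), with the conventions at q = \<infinity>. *)
definition inv_exp :: "ereal \<Rightarrow> real"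
  where "inv_exp q = (if q = \<infinity> then 0 else 1 / real_of_ereal q)"

definition crit_dim :: "real \<Rightarrow> ereal \<Rightarrow> real"
  where "crit_dim p q =
    (if q = \<infinity> then p else p * real_of_ereal q / (real_of_ereal q - p))"

definition rate :: "nat \<Rightarrow> real \<Rightarrow> ereal \<Rightarrow> nat \<Rightarrow> real"
  where "rate d p q N =
    (if real d \<noteq> crit_dim p q
     then max (real N powr (- 1 / p + inv_exp q)) (real N powr (- 1 / real d))
     else real N powr (- 1 / real d) * ln (1 + real N) powr (1 / real d))"

end

theory Submission
  imports Defs "HOL-Real_Asymp.Real_Asymp"
begin

text \<open>A Peano curve $h$ from the reals onto $\mathbf{R}^d$ is Hoelder continuous of order $1/d$, and every
  $x$ is $h(t)$ for some $t$ with $|t| \le C |x|^d$. Hence $\mu$ is the image under $h$ of a measure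
  on the line with finite moment of order $\sigma = q/d$, and it suffices to quantize that measure for
  the cost $|s - t|^r$ with $r = p/d$. There take the $i/N$-quantiles $t_i$ as nodes: the cell between
  $t_{i-1}$ and $t_i$ costs at most $(t_i - t_{i-1})^r / N$, and the two outermost cells are
  moved to 0. For $r \ge 1$ the increments are summed by superadditivity; for $r < 1$ a weighted
  Hoelder inequality bounds their sum by powers of $N$ and of the integral of
  $(1 + |t|)^{-\sigma (1 - r) / r}$ over $|t| \le N^{1/\sigma}$. This integral is bounded, logarithmic
  or a power of $N$ according to the sign of $d - pq/(q-p)$. In the last case everything is governed
  by the moment carried by the two outermost cells, which tends to 0.\<close>

section \<open>A Peano curve on the integers\<close>

text \<open>In dimension d the obstacle is that all atoms carry the same mass 1/N, so a partition
  into small cubes is of no direct use. On the line the quantile cells have equal mass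
  automatically, and a Hoelder curve of order 1/d transfers them with the right exponent: moving
  mass over a distance s on the line costs s^(p/d) in space. As \<mu> may be unbounded, the curve
  must be two-sided and self-similar about 0. Balanced ternary provides this: 0 is fixed, and
  dropping digits is rounding to the nearest integer. The weight exponent a = \<sigma> (1 - r) / r
  equals q (d - p) / (d p), so a < 1, a = 1, a > 1 correspond to d below, at, above pq/(q-p); the
  logarithm is that of the integral of 1 / (1 + |t|). The estimates keep a bound \<kappa> for the
  moment of the two outer cells apart from the total moment. With \<kappa> = 1 they give the bound
  for finite q, with \<kappa> tending to 0 the limit, and with \<kappa> = 2/N the case q =
  \<infinity>, p \<ge> d, where \<kappa> = 1 would only yield N^(r/\<sigma> - 1) instead of
  1/N.\<close>

definition sg :: "int \<Rightarrow> int"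
  where "sg z = (if even z then 1 else -1)"

text \<open>Peano's curve on the integers: $m$ is read in balanced ternary, lowest digit last, and the
  digits are dealt out cyclically to the $d$ coordinates. The two signs are the choice that makes
  the values at $m$ and $m + 1$ neighbours.\<close>

function peano :: "nat \<Rightarrow> int \<Rightarrow> nat \<Rightarrow> int"
  where "peano d m = (if m = 0 then (\<lambda>_. 0) else
    let m' = (m + 1) div 3; y = peano d m' in
    (\<lambda>i. if i = 0 then (-1) ^ (d - 1) * 3 * y (d - 1) + sg (m' + y (d - 1)) * ((m + 1) mod 3 - 1)
         else y (i - 1)))"
  by auto
termination by (relation "Wellfounded.measure (\<lambda>(d, m). nat \<bar>m\<bar>)") auto

declare peano.simps [simp del]

lemma peano_0 [simp]: "peano d 0 i = 0"
  by (simp add: peano.simps)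

text \<open>The case \<open>m = a = 0\<close>, where the recursion stops, is included because both
  sides vanish there. Later arguments can thus append digits to any number, also to 0.\<close>

lemma peano_step:
  assumes "a \<in> {-1, 0, 1}"
  shows "peano d (3 * m + a) 0 =
      (-1) ^ (d - 1) * 3 * peano d m (d - 1) + sg (m + peano d m (d - 1)) * a"
    and "peano d (3 * m + a) (Suc i) = peano d m i"
proof -
  have *: "(3 * m + a + 1) div 3 = m" "(3 * m + a + 1) mod 3 - 1 = a"
    using assms by auto
  have 0: "m = 0 \<and> a = 0" if "3 * m + a = 0"
    using assms that by (cases "m = 0") auto
  show "peano d (3 * m + a) 0 =
      (-1) ^ (d - 1) * 3 * peano d m (d - 1) + sg (m + peano d m (d - 1)) * a"
    using 0 by (subst peano.simps) (auto simp: * Let_def simp del: mult_cancel_left)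
  show "peano d (3 * m + a) (Suc i) = peano d m i"
    using 0 by (subst peano.simps) (auto simp: * Let_def)
qed

lemma balanced_ternary_cases:
  obtains m' a :: int where "m = 3 * m' + a" "a \<in> {-1, 0, 1}"
proof
  show "m = 3 * ((m + 1) div 3) + ((m + 1) mod 3 - 1)"
    by (simp add: algebra_simps)
  have "(m + 1) mod 3 \<in> {0..<3}" by simp
  then show "(m + 1) mod 3 - 1 \<in> {-1, 0, 1}" by auto
qed

text \<open>With \<open>T = 3 ^ j\<close> the condition \<open>2 * \<bar>e\<bar> < T\<close> says
  that \<open>e\<close> has at most j balanced ternary digits; dropping the last digit leaves one
  digit less. For \<open>T = 2 * c + 1\<close> the hypothesis means that the absolute value is at
  most 3 c + 1, whence that of \<open>e\<close> is at most c.\<close>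

lemma balanced_third_bound:
  fixes e a T :: int
  assumes "a \<in> {-1, 0, 1}" "odd T" "2 * \<bar>3 * e + a\<bar> < 3 * T"
  shows "2 * \<bar>e\<bar> < T"
proof -
  obtain c where T: "T = 2 * c + 1" using assms(2) by (rule oddE)
  define x y where "x = \<bar>e\<bar>" and "y = \<bar>3 * e + a\<bar>"
  have "3 * x \<le> y + 1" using assms(1) by (auto simp: x_def y_def)
  moreover have "2 * y < 3 * (2 * c + 1)" using assms(3) by (simp add: y_def T)
  ultimately have "2 * x < 2 * c + 1" by presburger
  then show ?thesis by (simp add: x_def T)
qed

text \<open>Modulo 2 the factor 3 and all signs disappear, and the two copies of \<open>a\<close>
  cancel. So a number plus coordinate 0 of its point has the parity of the parent plus coordinate
  \<open>d - 1\<close> of the parent's point.\<close>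

lemma sg_step: "sg (3 * m + a + ((-1) ^ k * 3 * y + sg z * a)) = sg (m + y)"
  by (auto simp: sg_def)

text \<open>The sign of the unit step is part of the statement, because the induction needs it
  when a carry moves the coordinate $d - 1$.\<close>

lemma peano_adjacent_step:
  assumes "0 < d"
  shows "\<exists>i<d. \<forall>j<d. peano d (m + 1) j - peano d m j =
    (if j = i then sg (int i + m + peano d m i) else 0)"
proof (induction "nat \<bar>m\<bar>" arbitrary: m rule: less_induct)
  case less
  obtain m' a where m: "m = 3 * m' + a" and a: "a \<in> {-1, 0, 1}"
    by (rule balanced_ternary_cases)
  define k where "k = d - 1"
  have par: "even ((-1::int) ^ k * 3 * z) \<longleftrightarrow> even z" for z by simp
  show ?case
  proof (cases "a = 1")
    case False
    \<comment> \<open>No carry: both numbers have the parent \<open>m'\<close>, so only the digit in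
      coordinate 0 changes, and \<open>sg_step\<close> identifies its sign with the claimed
      one.\<close>
    have m1: "m + 1 = 3 * m' + (a + 1)" and a1: "a + 1 \<in> {-1, 0, 1}"
      using m a False by auto
    show ?thesis
    proof (intro exI[of _ 0] conjI allI impI)
      fix j assume "j < d"
      show "peano d (m + 1) j - peano d m j =
        (if j = 0 then sg (int 0 + m + peano d m 0) else 0)"
      proof (cases j)
        case 0
        show ?thesis
          unfolding 0 unfolding m1 unfolding m peano_step[OF a] peano_step[OF a1]
          by (simp only: of_nat_0 add_0 sg_step) (simp add: algebra_simps)
      next
        case (Suc i)
        then show ?thesis
          unfolding m1 unfolding m by (simp add: peano_step[OF a] peano_step[OF a1])
      qed
    qed (use assms in auto)
  next
    case True
    \<comment> \<open>Carry: the last digit jumps from 1 to -1 while the parent advances by one,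
      which by induction moves a single coordinate of the parent's point.\<close>
    have m1: "m + 1 = 3 * (m' + 1) + (-1)" and a1: "(-1::int) \<in> {-1, 0, 1}"
      using m True by auto
    have m: "m = 3 * m' + 1" and a: "(1::int) \<in> {-1, 0, 1}"
      using m True by auto
    have "nat \<bar>m'\<bar> < nat \<bar>m\<bar>"
      unfolding m by (cases "m' < 0") auto
    from less[OF this] obtain i where i: "i < d" and
      y0: "\<And>j. j < d \<Longrightarrow> peano d (m' + 1) j - peano d m' j =
        (if j = i then sg (int i + m' + peano d m' i) else 0)"
      by blast
    have y: "peano d (m' + 1) j =
      peano d m' j + (if j = i then sg (int i + m' + peano d m' i) else 0)" if "j < d" for j
      using y0[OF that] by linarith
    have k: "k < d" "d = Suc k" using assms by (auto simp: k_def)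
    have z: "peano d (m + 1) 0 = (-1) ^ k * 3 * peano d (m' + 1) k
        - sg (m' + 1 + peano d (m' + 1) k)"
      "peano d m 0 = (-1) ^ k * 3 * peano d m' k + sg (m' + peano d m' k)"
      unfolding m1 unfolding m peano_step[OF a] peano_step[OF a1] by (simp_all add: k)
    have s: "peano d (m + 1) (Suc j) = peano d (m' + 1) j" "peano d m (Suc j) = peano d m' j" for j
      unfolding m1 unfolding m peano_step[OF a] peano_step[OF a1] by simp_all
    show ?thesis
    proof (cases "i = k")
      case False
      \<comment> \<open>Coordinate \<open>k\<close> of the parent rests while \<open>m'\<close>
        changes parity, so the two digit signs are opposite. As the digits are opposite too,
        coordinate 0 does not change, and only the shifted step of the parent remains.\<close>
      have yk: "peano d (m' + 1) k = peano d m' k" using y[OF k(1)] False by simp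
      have sgS: "sg (int (Suc i) + m + x) = sg (int i + m' + x)" for x
        by (simp add: sg_def m)
      show ?thesis
      proof (intro exI[of _ "Suc i"] conjI allI impI)
        show "Suc i < d" using i False k by simp
        fix j assume j: "j < d"
        show "peano d (m + 1) j - peano d m j =
          (if j = Suc i then sg (int (Suc i) + m + peano d m (Suc i)) else 0)"
        proof (cases j)
          case 0
          then show ?thesis
            unfolding 0 z yk by (auto simp: sg_def)
        next
          case (Suc l)
          then show ?thesis
            using y[of l] j by (simp add: s sgS del: of_nat_Suc)
        qed
      qed
    next
      case True
      \<comment> \<open>Now \<open>m'\<close> and coordinate \<open>k\<close> both change parity, so
        the digit signs agree. With \<open>e = sg (m' + peano d m' k)\<close> the parent's step
        enters coordinate 0 as 3 e, because \<open>(-1) ^ k\<close> cancels the \<open>int k\<close>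
        in its sign, and the digits take back 2 e. The net step is e.\<close>
      have yk: "peano d (m' + 1) k = peano d m' k + sg (int k + m' + peano d m' k)"
        using y[OF k(1)] True by simp
      show ?thesis
      proof (intro exI[of _ 0] conjI allI impI)
        show "0 < d" by fact
        fix j assume j: "j < d"
        show "peano d (m + 1) j - peano d m j =
          (if j = 0 then sg (int 0 + m + peano d m 0) else 0)"
        proof (cases j)
          case 0
          show ?thesis
            unfolding 0 z yk unfolding m
            using sg_step[of m' 1 k "peano d m' k" "m' + peano d m' k"]
            by (cases "even k"; cases "even m'"; cases "even (peano d m' k)") (simp_all add: sg_def)
        next
          case (Suc l)
          then have l: "l < d" "l \<noteq> i" using j True k(2) by simp_all
          show ?thesis
            unfolding Suc s y[OF l(1)] using l by simp
        qed
      qed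
    qed
  qed
qed

section \<open>Neighbours, descendants and range of the integer curve\<close>

lemma peano_adjacent:
  assumes "\<bar>m - n\<bar> \<le> 1" "i < d"
  shows "\<bar>peano d m i - peano d n i\<bar> \<le> 1"
proof -
  have step: "\<bar>peano d (m + 1) i - peano d m i\<bar> \<le> 1" for m
    using peano_adjacent_step[of d m] assms(2) by (fastforce simp: sg_def split: if_splits)
  consider "m = n" | "m = n + 1" | "n = m + 1" using assms(1) by linarith
  then show ?thesis
    using step[of n] step[of m] by cases (auto simp: abs_minus_commute)
qed

text \<open>Each appended digit shifts the coordinates by one place. As \<open>j \<le> d\<close>, a
  coordinate passes from place \<open>d - 1\<close> to place 0 at most once; only then does it
  acquire the factor and a single digit, which is the error of at most 1.\<close>

lemma peano_descendant_aux:
  assumes "j \<le> d" "2 * \<bar>e\<bar> < 3 ^ j" "i < d"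
  shows "(i < j \<longrightarrow> \<bar>peano d (3 ^ j * m + e) i
      - (-1) ^ (d - 1) * 3 * peano d m (d + i - j)\<bar> \<le> 1) \<and>
    (j \<le> i \<longrightarrow> peano d (3 ^ j * m + e) i = peano d m (i - j))"
  using assms
proof (induction j arbitrary: e i)
  case (Suc j)
  obtain e' a where e: "e = 3 * e' + a" and a: "a \<in> {-1, 0, 1}"
    by (rule balanced_ternary_cases)
  have e': "2 * \<bar>e'\<bar> < 3 ^ j"
    by (rule balanced_third_bound[OF a]) (use Suc.prems(2) in \<open>auto simp: e\<close>)
  have M: "3 ^ Suc j * m + e = 3 * (3 ^ j * m + e') + a" by (simp add: e)
  show ?case
  proof (cases i)
    case 0
    have "peano d (3 ^ j * m + e') (d - 1) = peano d m (d - 1 - j)"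
      using Suc.IH[OF _ e', of "d - 1"] Suc.prems by auto
    moreover have "\<bar>sg (3 ^ j * m + e' + peano d (3 ^ j * m + e') (d - 1)) * a\<bar> \<le> 1"
      using a by (auto simp: sg_def)
    ultimately show ?thesis
      unfolding M 0 peano_step[OF a] by simp
  next
    case (Suc l)
    then have "l < d" using Suc.prems by simp
    then show ?thesis
      unfolding M Suc peano_step[OF a] using Suc.IH[OF _ e', of l] Suc.prems by simp
  qed
next
  case 0
  then have "e = 0" by simp
  then show ?case by simp
qed

lemma peano_descendant:
  assumes "2 * \<bar>e\<bar> < 3 ^ d" "i < d"
  shows "\<bar>peano d (3 ^ d * m + e) i - (-1) ^ (d - 1) * 3 * peano d m i\<bar> \<le> 1"
  using peano_descendant_aux[of d d e i m] assms by simp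

text \<open>The exponents are chosen such that one step of the recursion rotates them,
  raising the one that reaches coordinate 0.\<close>

lemma peano_onto_box_aux:
  assumes "0 < d" "\<And>i. i < d \<Longrightarrow> 2 * \<bar>x i\<bar> < 3 ^ ((n + d - 1 - i) div d)"
  shows "\<exists>m. 2 * \<bar>m\<bar> < 3 ^ n \<and> (\<forall>i<d. peano d m i = x i)"
  using assms(2)
proof (induction n arbitrary: x)
  case 0
  have "x i = 0" if "i < d" for i using 0[OF that] that by simp
  then show ?case by (intro exI[of _ 0]) auto
next
  case (Suc n)
  define k where "k = d - 1"
  have k: "d = Suc k" using assms(1) by (simp add: k_def)
  obtain z a where z: "x 0 = 3 * z + a" and a: "a \<in> {-1, 0, 1}"
    by (rule balanced_ternary_cases)
  \<comment> \<open>The parent's point: the digit is removed from coordinate 0, which goes back to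
    place \<open>k\<close> with its sign undone, while the others move down.\<close>
  define y where "y i = (if i = k then (-1) ^ k * z else x (Suc i))" for i
  have "\<exists>m. 2 * \<bar>m\<bar> < 3 ^ n \<and> (\<forall>i<d. peano d m i = y i)"
  proof (rule Suc.IH)
    fix i assume i: "i < d"
    show "2 * \<bar>y i\<bar> < 3 ^ ((n + d - 1 - i) div d)"
    proof (cases "i = k")
      case True
      have "(Suc n + d - 1 - 0) div d = (n + d) div d" by simp
      then have "(Suc n + d - 1 - 0) div d = Suc (n div d)" using assms(1) by simp
      then have "2 * \<bar>3 * z + a\<bar> < 3 * 3 ^ (n div d)" using Suc.prems[of 0] assms(1) z by simp
      from balanced_third_bound[OF a _ this] have "2 * \<bar>z\<bar> < 3 ^ (n div d)" by simp
      then show ?thesis using True k by (simp add: y_def abs_mult)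
    next
      case False
      then have "2 * \<bar>x (Suc i)\<bar> < 3 ^ ((Suc n + d - 1 - Suc i) div d)"
        using Suc.prems[of "Suc i"] i k by simp
      then show ?thesis using False by (simp add: y_def)
    qed
  qed
  then obtain m where m: "2 * \<bar>m\<bar> < 3 ^ n" "\<And>i. i < d \<Longrightarrow> peano d m i = y i" by blast
  \<comment> \<open>The recursion multiplies the digit by this sign again, and the square of a sign
    is 1.\<close>
  define b where "b = sg (m + y k) * a"
  have b: "b \<in> {-1, 0, 1}" using a by (auto simp: b_def sg_def)
  have "peano d (3 * m + b) i = x i" if i: "i < d" for i
  proof (cases i)
    case 0
    have "sg (m + y k) * b = a" by (auto simp: b_def sg_def)
    then show ?thesis
      unfolding 0 peano_step[OF b] z using m(2)[of k] k
      by (cases "even k") (simp_all add: y_def)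
  next
    case (Suc l)
    then have "l < k" using i k by simp
    then show ?thesis
      unfolding Suc peano_step[OF b] using m(2)[of l] k by (simp add: y_def)
  qed
  moreover have "2 * \<bar>3 * m + b\<bar> < 3 ^ Suc n"
  proof -
    have "\<bar>3 * m + b\<bar> \<le> 3 * \<bar>m\<bar> + 1" using b by auto
    then show ?thesis using m(1) by simp
  qed
  ultimately show ?case by blast
qed

text \<open>For a multiple of \<open>d\<close> digits the rotating exponents all coincide.\<close>

lemma peano_onto_box:
  assumes "0 < d" "\<And>i. i < d \<Longrightarrow> 2 * \<bar>x i\<bar> < 3 ^ k"
  obtains m where "2 * \<bar>m\<bar> < 3 ^ (d * k)" "\<And>i. i < d \<Longrightarrow> peano d m i = x i"
proof -
  have "(d * k + d - 1 - i) div d = k" if "i < d" for i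
  proof -
    have "d * k + d - 1 - i = d * k + (d - 1 - i)" using that by simp
    then show ?thesis using that by (simp only: div_mult_self3 div_mult_self4) simp
  qed
  then show thesis
    using peano_onto_box_aux[of d x "d * k"] assms that by auto
qed

section \<open>A space-filling curve\<close>

definition rnd :: "real \<Rightarrow> int"
  where "rnd x = \<lfloor>x + 1 / 2\<rfloor>"

lemma rnd_of_int [simp]: "rnd (of_int m) = m"
  by (simp add: rnd_def floor_eq_iff)

lemma rnd_error: "\<bar>x - of_int (rnd x)\<bar> \<le> 1 / 2"
  unfolding rnd_def by linarith

lemma rnd_diff:
  assumes "\<bar>x - y\<bar> \<le> 1"
  shows "\<bar>rnd x - rnd y\<bar> \<le> 1"
  using assms unfolding rnd_def by linarith

text \<open>Rounding to the nearest integer is compatible with tripling because \<open>3 ^ n\<close>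
  is odd: for 3^n = 2 c + 1, scaling the half-open interval from -1/2 to 1/2 yields exactly the unit
  intervals centred at -c, ..., c. Hence the finer rounding appends n balanced digits to the coarser
  one.\<close>

lemma rnd_scale: "2 * \<bar>rnd (3 ^ n * x) - 3 ^ n * rnd x\<bar> < 3 ^ n"
proof -
  have "odd ((3::int) ^ n)" by simp
  then obtain c :: int where c: "3 ^ n = 2 * c + 1" by (rule oddE)
  define T :: int where "T = 3 ^ n"
  have T: "(3::real) ^ n = of_int T" "T > 0" by (simp_all add: T_def)
  define f where "f = x - of_int (rnd x)"
  have f: "- (1 / 2) \<le> f" "f < 1 / 2" unfolding f_def rnd_def by linarith+
  have "of_int T * x + 1 / 2 = of_int T * f + 1 / 2 + of_int (T * rnd x)"
    by (simp add: f_def algebra_simps)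
  then have "rnd (of_int T * x) - T * rnd x = \<lfloor>of_int T * f + 1 / 2\<rfloor>"
    unfolding rnd_def[of "of_int T * x"] by (simp only: floor_add_int[symmetric])
  also have "2 * \<bar>\<lfloor>of_int T * f + 1 / 2\<rfloor>\<bar> < T"
  proof -
    define g where "g = of_int T * f"
    have "g < of_int T * (1 / 2)" "of_int T * (- (1 / 2)) \<le> g"
      unfolding g_def using f T(2) by (intro mult_strict_left_mono mult_left_mono; simp)+
    moreover have "T = 2 * c + 1" using c T_def by simp
    ultimately have "g < of_int c + 1 / 2" "- of_int c - 1 / 2 \<le> g"
      by (simp_all add: add_divide_distrib)
    then have "\<lfloor>of_int T * f + 1 / 2\<rfloor> \<le> c" "- c \<le> \<lfloor>of_int T * f + 1 / 2\<rfloor>"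
      unfolding g_def[symmetric] floor_le_iff le_floor_iff by simp_all
    then show ?thesis using c T_def by linarith
  qed
  finally show ?thesis unfolding T(1) T_def by simp
qed

text \<open>Appending $d$ digits multiplies the integer curve by \<open>theta d\<close>, up to an error of 1.\<close>

definition theta :: "nat \<Rightarrow> real"
  where "theta d = (-1) ^ (d - 1) * 3"

lemma abs_theta [simp]: "\<bar>theta d\<bar> = 3"
  by (simp add: theta_def abs_mult)

lemma theta_neq_0 [simp]: "theta d \<noteq> 0"
  by (simp add: theta_def)

definition peano_approx :: "nat \<Rightarrow> nat \<Rightarrow> real \<Rightarrow> nat \<Rightarrow> real"
  where "peano_approx d k t i = of_int (peano d (rnd (3 ^ (d * k) * t)) i) / theta d ^ k"

text \<open>Convergence is shown for \<open>i < d\<close>, the only coordinates used.\<close>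

definition peano_curve :: "nat \<Rightarrow> real \<Rightarrow> nat \<Rightarrow> real"
  where "peano_curve d t i = lim (\<lambda>k. peano_approx d k t i)"

text \<open>One more level appends d digits, and their error of at most 1 is divided by the new
  scale.\<close>

lemma peano_approx_Suc:
  assumes "i < d"
  shows "\<bar>peano_approx d (Suc k) t i - peano_approx d k t i\<bar> \<le> (1 / 3) ^ Suc k"
proof -
  define m where "m = rnd (3 ^ (d * k) * t)"
  define M where "M = rnd (3 ^ (d * Suc k) * t)"
  have M: "M = rnd (3 ^ d * (3 ^ (d * k) * t))"
    by (simp add: M_def power_add mult.assoc)
  have "\<bar>peano d (3 ^ d * m + (M - 3 ^ d * m)) i - (-1) ^ (d - 1) * 3 * peano d m i\<bar> \<le> 1"
    using rnd_scale[of d "3 ^ (d * k) * t"] assms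
    by (intro peano_descendant) (simp_all add: M m_def)
  then have "\<bar>of_int (peano d M i - (-1) ^ (d - 1) * 3 * peano d m i) :: real\<bar> \<le> 1"
    by (simp only: of_int_abs[symmetric] of_int_le_1_iff) simp
  then have *: "\<bar>of_int (peano d M i) - theta d * of_int (peano d m i)\<bar> \<le> 1"
    by (simp add: theta_def)
  have "peano_approx d (Suc k) t i - peano_approx d k t i
      = (of_int (peano d M i) - theta d * of_int (peano d m i)) / theta d ^ Suc k"
    unfolding peano_approx_def m_def[symmetric] M_def[symmetric] by (simp add: field_simps)
  also have "\<bar>\<dots>\<bar> \<le> 1 / 3 ^ Suc k"
    unfolding abs_divide power_abs abs_theta using * by (intro divide_right_mono) auto
  finally show ?thesis by (simp add: power_one_over)
qed

text \<open>The second factor is the geometric sum of 3^-1, ..., 3^-j. Kept exact, it closes the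
  induction and leaves the constant 1/2 in the limit.\<close>

lemma peano_approx_add:
  assumes "i < d"
  shows "\<bar>peano_approx d (k + j) t i - peano_approx d k t i\<bar> \<le> (1 / 3) ^ k * (1 / 2 - (1 / 3) ^ j / 2)"
proof (induction j)
  case (Suc j)
  have "\<bar>peano_approx d (k + Suc j) t i - peano_approx d k t i\<bar>
      \<le> (1 / 3) ^ Suc (k + j) + (1 / 3) ^ k * (1 / 2 - (1 / 3) ^ j / 2)"
    using Suc peano_approx_Suc[OF assms, of "k + j" t] unfolding add_Suc_right by linarith
  also have "\<dots> = (1 / 3) ^ k * (1 / 2 - (1 / 3) ^ Suc j / 2)"
    by (simp add: power_add field_simps)
  finally show ?case .
qed simp

lemma peano_approx_tendsto:
  assumes "i < d"
  shows "(\<lambda>k. peano_approx d k t i) \<longlonglongrightarrow> peano_curve d t i"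
proof -
  have bnd: "\<bar>peano_approx d (k + j) t i - peano_approx d k t i\<bar> \<le> (1 / 3) ^ k" for k j
  proof -
    have "(1 / 3) ^ k * (1 / 2 - (1 / 3) ^ j / 2) \<le> (1 / 3 :: real) ^ k * 1"
    proof (intro mult_left_mono)
      have "0 \<le> (1 / 3 :: real) ^ j" by simp
      then show "1 / 2 - (1 / 3) ^ j / 2 \<le> (1::real)" by linarith
    qed simp
    then show ?thesis using peano_approx_add[OF assms, of k j t] by linarith
  qed
  have "Cauchy (\<lambda>k. peano_approx d k t i)"
  proof (rule CauchyI')
    fix e :: real assume "0 < e"
    then obtain M where M: "(1 / 3 :: real) ^ M < e / 2"
      using real_arch_pow_inv[of "e / 2" "1 / 3"] by auto
    show "\<exists>M. \<forall>m\<ge>M. \<forall>n>m. dist (peano_approx d m t i) (peano_approx d n t i) < e"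
    proof (intro exI[of _ M] allI impI)
      fix m n assume "M \<le> m" "m < n"
      then have "m = M + (m - M)" "n = M + (n - M)" by simp_all
      then have "\<bar>peano_approx d m t i - peano_approx d M t i\<bar> \<le> (1 / 3) ^ M"
        "\<bar>peano_approx d n t i - peano_approx d M t i\<bar> \<le> (1 / 3) ^ M"
        using bnd by metis+
      then show "dist (peano_approx d m t i) (peano_approx d n t i) < e"
        using M unfolding dist_real_def by linarith
    qed
  qed
  then show ?thesis
    unfolding peano_curve_def by (simp add: Cauchy_convergent_iff convergent_LIMSEQ_iff)
qed

lemma peano_curve_approx:
  assumes "i < d"
  shows "\<bar>peano_curve d t i - peano_approx d k t i\<bar> \<le> (1 / 3) ^ k / 2"
proof (rule LIMSEQ_le_const2)
  show "(\<lambda>j. \<bar>peano_approx d (j + k) t i - peano_approx d k t i\<bar>)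
      \<longlonglongrightarrow> \<bar>peano_curve d t i - peano_approx d k t i\<bar>"
    by (intro tendsto_intros LIMSEQ_ignore_initial_segment peano_approx_tendsto assms)
  have "\<bar>peano_approx d (j + k) t i - peano_approx d k t i\<bar> \<le> (1 / 3) ^ k / 2" for j
  proof -
    have "(1 / 3) ^ k * (1 / 2 - (1 / 3) ^ j / 2) \<le> (1 / 3 :: real) ^ k * (1 / 2)"
      by (intro mult_left_mono) auto
    then show ?thesis
      using peano_approx_add[OF assms, of k j t] unfolding add.commute[of j k] by linarith
  qed
  then show "\<exists>N. \<forall>j\<ge>N. \<bar>peano_approx d (j + k) t i - peano_approx d k t i\<bar> \<le> (1 / 3) ^ k / 2"
    by blast
qed

text \<open>Self-similarity is exact before the limit: enlarging the argument by
  \<open>3 ^ (d * n)\<close> merely shifts the level by \<open>n\<close>.\<close>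

lemma peano_curve_scale_nat:
  assumes "i < d"
  shows "peano_curve d (3 ^ (d * n) * t) i = theta d ^ n * peano_curve d t i"
proof (rule LIMSEQ_unique)
  show "(\<lambda>k. peano_approx d k (3 ^ (d * n) * t) i) \<longlonglongrightarrow> peano_curve d (3 ^ (d * n) * t) i"
    by (rule peano_approx_tendsto[OF assms])
  have "peano_approx d k (3 ^ (d * n) * t) i = theta d ^ n * peano_approx d (k + n) t i" for k
    by (simp add: peano_approx_def power_add ring_distribs mult.assoc)
  then show "(\<lambda>k. peano_approx d k (3 ^ (d * n) * t) i) \<longlonglongrightarrow> theta d ^ n * peano_curve d t i"
    by (simp only:) (intro tendsto_intros LIMSEQ_ignore_initial_segment peano_approx_tendsto assms)
qed

lemma peano_curve_scale:
  assumes "i < d"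
  shows "peano_curve d ((3 ^ d) powi k * t) i = theta d powi k * peano_curve d t i"
proof (cases "k \<ge> 0")
  case True
  then show ?thesis
    using peano_curve_scale_nat[OF assms, of "nat k" t] by (simp add: power_int_def power_mult)
next
  case False
  define n where "n = nat (- k)"
  have "peano_curve d (3 ^ (d * n) * (t / 3 ^ (d * n))) i = theta d ^ n * peano_curve d (t / 3 ^ (d * n)) i"
    by (rule peano_curve_scale_nat[OF assms])
  then show ?thesis
    using False by (simp add: power_int_def power_mult field_simps flip: n_def)
qed

text \<open>By self-similarity only distances in $[0, 1]$ need to be considered,
  and there the approximation of level 0 is good enough.\<close>

lemma peano_curve_Hoelder:
  assumes "i < d"
  shows "\<bar>peano_curve d s i - peano_curve d t i\<bar> \<le> 6 * \<bar>s - t\<bar> powr (1 / real d)"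
proof (cases "s = t")
  case False
  define r where "r = \<bar>s - t\<bar>"
  have r: "0 < r" using False by (simp add: r_def)
  have d: "0 < d" using assms by simp
  define D where "D = (3::real) ^ d"
  have D: "1 < D" "0 < D" using d by (simp_all add: D_def)
  \<comment> \<open>The least power of \<open>3 ^ d\<close> that is not below the distance. It
    exceeds the distance at most by a factor \<open>3 ^ d\<close>, whose d-th root is the 3 in
    \<open>k2\<close>.\<close>
  define k where "k = \<lceil>log D r\<rceil>"
  have k1: "r \<le> D powi k"
  proof -
    have "r = D powr (log D r)" using r D by simp
    also have "\<dots> \<le> D powr k" unfolding k_def using D by (intro powr_mono) auto
    finally show ?thesis using D by (simp add: powr_real_of_int')
  qed
  have k2: "3 powi k \<le> 3 * r powr (1 / d)"
  proof -
    have "(3::real) powi k = (D powr k) powr (1 / d)"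
      using d by (simp add: D_def powr_powr powr_real_of_int' flip: powr_realpow)
    also have "\<dots> \<le> (D powr (log D r + 1)) powr (1 / d)"
      unfolding k_def using D by (intro powr_mono2 powr_mono) auto
    also have "\<dots> = (D * r) powr (1 / d)"
      using D r by (simp add: powr_add mult.commute)
    also have "\<dots> = 3 * r powr (1 / d)"
      using D r d by (simp add: powr_mult D_def powr_powr flip: powr_realpow)
    finally show ?thesis .
  qed
  define u v where "u = s / D powi k" and "v = t / D powi k"
  have Dk: "0 < D powi k" using D by simp
  have st: "s = D powi k * u" "t = D powi k * v" using Dk by (simp_all add: u_def v_def del: power_int_eq_0_iff)
  have "\<bar>u - v\<bar> = r / D powi k" using Dk by (simp add: u_def v_def r_def flip: diff_divide_distrib)
  then have "\<bar>u - v\<bar> \<le> 1" using k1 Dk by simp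
  then have "\<bar>peano d (rnd u) i - peano d (rnd v) i\<bar> \<le> 1"
    by (intro peano_adjacent rnd_diff assms)
  then have "\<bar>of_int (peano d (rnd u) i - peano d (rnd v) i) :: real\<bar> \<le> 1"
    by (simp only: of_int_abs[symmetric] of_int_le_1_iff) 
  then have "\<bar>peano_approx d 0 u i - peano_approx d 0 v i\<bar> \<le> 1"
    by (simp add: peano_approx_def)
  \<comment> \<open>Neighbouring integer points contribute 1 and the two errors at level 0
    contribute 1/2 each. Together with the 3 of \<open>k2\<close> this makes 6.\<close>
  then have uv: "\<bar>peano_curve d u i - peano_curve d v i\<bar> \<le> 2"
    using peano_curve_approx[OF assms, of u 0] peano_curve_approx[OF assms, of v 0]
    unfolding power_0 by linarith
  have "peano_curve d s i - peano_curve d t i = theta d powi k * (peano_curve d u i - peano_curve d v i)"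
    unfolding st D_def peano_curve_scale[OF assms] by (simp add: algebra_simps)
  also have "\<bar>\<dots>\<bar> = 3 powi k * \<bar>peano_curve d u i - peano_curve d v i\<bar>"
    by (simp add: abs_mult power_int_abs)
  also have "\<dots> \<le> 3 powi k * 2" using uv by (intro mult_left_mono) auto
  also have "\<dots> \<le> 6 * r powr (1 / d)" using k2 by simp
  finally show ?thesis unfolding r_def .
qed simp

text \<open>The radius 1/4 leaves room for the rounding error: 3^k / 4 + 1/2 stays below 3^k / 2 as
  soon as \<open>3 ^ k\<close> exceeds 2, which is why level 0 is excluded.\<close>

lemma peano_curve_dense_in_box:
  assumes "0 < d" "\<And>i. i < d \<Longrightarrow> \<bar>x i\<bar> \<le> 1 / 4" "1 \<le> k"
  obtains t where "\<bar>t\<bar> \<le> 1" "\<And>i. i < d \<Longrightarrow> \<bar>peano_curve d t i - x i\<bar> \<le> (1 / 3) ^ k"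
proof -
  define z where "z i = rnd (theta d ^ k * x i)" for i
  have abs_th: "\<bar>theta d ^ k\<bar> = 3 ^ k" by (simp add: power_abs)
  have "2 * \<bar>z i\<bar> < 3 ^ k" if "i < d" for i
  proof -
    have "\<bar>theta d ^ k * x i\<bar> \<le> 3 ^ k * (1 / 4)"
      unfolding abs_mult abs_th using assms(2)[OF that] by (intro mult_left_mono) auto
    then have "\<bar>real_of_int (z i)\<bar> \<le> 3 ^ k / 4 + 1 / 2"
      using rnd_error[of "theta d ^ k * x i"] unfolding z_def by linarith
    moreover have "(3::real) ^ 1 \<le> 3 ^ k" using assms(3) by (intro power_increasing) auto
    ultimately have "2 * \<bar>real_of_int (z i)\<bar> < 3 ^ k" by simp
    also have "2 * \<bar>real_of_int (z i)\<bar> = of_int (2 * \<bar>z i\<bar>)" by simp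
    also have "(3::real) ^ k = of_int (3 ^ k)" by simp
    finally show ?thesis unfolding of_int_less_iff .
  qed
  then obtain m where m: "2 * \<bar>m\<bar> < 3 ^ (d * k)" "\<And>i. i < d \<Longrightarrow> peano d m i = z i"
    using peano_onto_box[OF assms(1), of z k] by blast
  define t :: real where "t = of_int m / 3 ^ (d * k)"
  show thesis
  proof
    have "real_of_int \<bar>m\<bar> \<le> of_int (3 ^ (d * k))" unfolding of_int_le_iff using m(1) by linarith
    then show "\<bar>t\<bar> \<le> 1" by (simp add: t_def)
    fix i assume i: "i < d"
    have "peano_approx d k t i = of_int (z i) / theta d ^ k"
      unfolding peano_approx_def t_def using m(2)[OF i] by simp
    then have "peano_approx d k t i - x i = (of_int (z i) - theta d ^ k * x i) / theta d ^ k"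
      by (simp add: diff_divide_distrib)
    also have "\<bar>\<dots>\<bar> \<le> (1 / 2) / 3 ^ k"
      unfolding abs_divide abs_th using rnd_error[of "theta d ^ k * x i"]
      by (intro divide_right_mono) (auto simp: z_def abs_minus_commute)
    finally have "\<bar>peano_approx d k t i - x i\<bar> \<le> (1 / 3) ^ k / 2" by (simp add: power_one_over)
    then show "\<bar>peano_curve d t i - x i\<bar> \<le> (1 / 3) ^ k"
      using peano_curve_approx[OF i, of t k] by linarith
  qed
qed

lemma Hoelder_imp_continuous:
  fixes h :: "real \<Rightarrow> 'a::real_normed_vector"
  assumes "\<And>s t. norm (h s - h t) \<le> C * \<bar>s - t\<bar> powr b" "0 < b"
  shows "continuous_on UNIV h"
  unfolding continuous_on_def
proof
  fix x
  have "((\<lambda>y. C * \<bar>y - x\<bar> powr b) \<longlongrightarrow> C * \<bar>x - x\<bar> powr b) (at x)"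
    using assms(2) by (intro tendsto_intros tendsto_powr') auto
  then have "((\<lambda>y. C * \<bar>y - x\<bar> powr b) \<longlongrightarrow> 0) (at x)" by simp
  then have "((\<lambda>y. h y - h x) \<longlongrightarrow> 0) (at x)"
    by (rule Lim_null_comparison[rotated]) (use assms(1) in auto)
  then show "(h \<longlongrightarrow> h x) (at x within UNIV)" by (simp add: LIM_zero_iff)
qed

theorem space_filling_curve:
  obtains h :: "real \<Rightarrow> real ^ 'n::finite" and C :: real where "C > 0"
    "\<And>s t. norm (h s - h t) \<le> C * \<bar>s - t\<bar> powr (1 / CARD('n))"
    "\<And>x. \<exists>t. h t = x \<and> \<bar>t\<bar> \<le> C * norm x ^ CARD('n)"
proof -
  define d where "d = CARD('n)"
  have d: "0 < d" by (simp add: d_def)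
  obtain f :: "'n \<Rightarrow> nat" where f: "bij_betw f UNIV {0..<d}"
    using ex_bij_betw_finite_nat[of "UNIV :: 'n set"] by (auto simp: d_def)
  have fd: "f i < d" for i using f by (auto simp: bij_betw_def)
  have inj: "inj f" using f by (simp add: bij_betw_def)
  define h :: "real \<Rightarrow> real ^ 'n" where "h t = (\<chi> i. peano_curve d t (f i))" for t
  have h_nth: "h t $ i = peano_curve d t (f i)" for t i by (simp add: h_def)
  have norm_bound: "norm x \<le> d * B" if "\<And>i. \<bar>x $ i\<bar> \<le> B" for x :: "real ^ 'n" and B :: real
  proof -
    have "norm x \<le> (\<Sum>i\<in>UNIV. \<bar>x $ i\<bar>)" by (rule norm_le_l1_cart)
    also have "\<dots> \<le> (\<Sum>i\<in>(UNIV::'n set). B)" by (intro sum_mono that)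
    finally show ?thesis by (simp add: d_def)
  qed
  have Hoelder: "norm (h s - h t) \<le> 6 * d * \<bar>s - t\<bar> powr (1 / d)" for s t
  proof -
    have "norm (h s - h t) \<le> d * (6 * \<bar>s - t\<bar> powr (1 / d))"
      by (intro norm_bound) (simp add: h_nth peano_curve_Hoelder[OF fd])
    then show ?thesis by (simp add: mult_ac)
  qed
  have cont: "continuous_on UNIV h"
    by (rule Hoelder_imp_continuous[OF Hoelder]) (use d in simp)
  \<comment> \<open>The image of a compact interval is closed, so approximating every point of the
    box suffices.\<close>
  have onto_box: "x \<in> h ` {-1..1}" if x: "\<And>i. \<bar>x $ i\<bar> \<le> 1 / 4" for x
  proof -
    have "compact (h ` {-1..1})"
      by (intro compact_continuous_image continuous_on_subset[OF cont]) auto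
    then have "closed (h ` {-1..1})" by (rule compact_imp_closed)
    moreover have "x \<in> closure (h ` {-1..1})"
      unfolding closure_approachable
    proof (intro allI impI)
      fix e :: real assume e: "0 < e"
      obtain k where k: "(1 / 3 :: real) ^ k < e / d"
        using real_arch_pow_inv[of "e / d" "1 / 3"] e d by auto
      have "(1 / 3 :: real) ^ Suc k \<le> (1 / 3) ^ k" by (intro power_decreasing) auto
      with k have k: "(1 / 3 :: real) ^ Suc k < e / d" by (rule order.strict_trans1[rotated])
      obtain t where t: "\<bar>t\<bar> \<le> 1"
        "\<And>j. j < d \<Longrightarrow> \<bar>peano_curve d t j - x $ (inv f j)\<bar> \<le> (1 / 3) ^ Suc k"
        using peano_curve_dense_in_box[OF d, of "\<lambda>j. x $ (inv f j)" "Suc k"] x by auto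
      have "norm (h t - x) \<le> d * (1 / 3) ^ Suc k"
        using t(2)[OF fd] by (intro norm_bound) (simp add: h_nth inv_f_f[OF inj] del: power_Suc)
      also have "\<dots> < e" using k d by (simp add: field_simps del: power_Suc)
      finally show "\<exists>y\<in>h ` {-1..1}. dist y x < e"
        using t(1) by (intro bexI[of _ "h t"] imageI) (auto simp: dist_norm abs_le_iff)
    qed
    ultimately show ?thesis by simp
  qed
  have scale: "h ((3 ^ d) powi k * t) = theta d powi k *\<^sub>R h t" for k t
    by (simp add: vec_eq_iff h_nth peano_curve_scale[OF fd])
  have onto: "\<exists>t. h t = x \<and> \<bar>t\<bar> \<le> 12 ^ d * norm x ^ d" for x
  proof (cases "x = 0")
    case True
    \<comment> \<open>Scaling fixes the argument 0 but multiplies the value by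
      \<open>theta d\<close>, which differs from 1, so the curve passes through the origin at time
      0.\<close>
    have "h 0 = theta d *\<^sub>R h 0" using scale[of 1 0] by simp
    moreover have "theta d \<noteq> 1" using abs_theta[of d] by (metis abs_1 one_eq_numeral_iff semiring_norm(86) num.distinct(5))
    ultimately have "h 0 = 0" by (metis scaleR_one scaleR_right_imp_eq)
    then show ?thesis using True d by (intro exI[of _ 0]) auto
  next
    case False
    \<comment> \<open>The least scale that brings \<open>x\<close> into the box of radius 1/4. It is
      at most \<open>12 * norm x\<close>, and time scales with its d-th power, which produces
      \<open>12 ^ d\<close>.\<close>
    define k where "k = \<lceil>log 3 (4 * norm x)\<rceil>"
    have p: "0 < 4 * norm x" using False by simp
    have "4 * norm x = 3 powr log 3 (4 * norm x)" using p by simp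
    also have "\<dots> \<le> 3 powr k" unfolding k_def by (intro powr_mono) auto
    also have "\<dots> = 3 powi k" by (simp add: powr_real_of_int')
    finally have k1: "4 * norm x \<le> 3 powi k" .
    have "(3::real) powi k = 3 powr k" by (simp add: powr_real_of_int')
    also have "\<dots> \<le> 3 powr (log 3 (4 * norm x) + 1)" unfolding k_def by (intro powr_mono) auto
    also have "\<dots> = 12 * norm x" unfolding powr_add using p by simp
    finally have k2: "(3::real) powi k \<le> 12 * norm x" .
    have k0: "(0::real) < 3 powi k" by simp
    define y where "y = (1 / theta d powi k) *\<^sub>R x"
    have "\<bar>y $ i\<bar> \<le> 1 / 4" for i
    proof -
      have "\<bar>y $ i\<bar> = \<bar>x $ i\<bar> / 3 powi k" by (simp add: y_def abs_divide power_int_abs)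
      also have "\<dots> \<le> (3 powi k / 4) / 3 powi k"
        using component_le_norm_cart[of x i] k1 k0 by (intro divide_right_mono) linarith+
      finally show ?thesis using k0 by simp
    qed
    then obtain t where t: "t \<in> {-1..1}" "h t = y" using onto_box[of y] by auto
    have D0: "(0::real) < (3 ^ d) powi k" by simp
    have "h ((3 ^ d) powi k * t) = x" unfolding scale t(2) y_def by simp
    moreover have "\<bar>(3 ^ d) powi k * t\<bar> \<le> (3 ^ d) powi k * 1"
      unfolding abs_mult using t(1) by (intro mult_mono) auto
    moreover have "(3 ^ d) powi k = ((3::real) powi k) ^ d"
      by (simp add: power_int_power' power_int_power mult.commute)
    moreover have "((3::real) powi k) ^ d \<le> (12 * norm x) ^ d"
      using k0 k2 by (intro power_mono) linarith+
    ultimately show ?thesis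
      by (intro exI[of _ "(3 ^ d) powi k * t"]) (auto simp: power_mult_distrib)
  qed
  define C where "C = max (6 * real d) (12 ^ d)"
  show thesis
  proof
    show "C > 0" using d by (simp add: C_def)
    show "norm (h s - h t) \<le> C * \<bar>s - t\<bar> powr (1 / CARD('n))" for s t
      using Hoelder[of s t] unfolding d_def[symmetric]
      by (rule order_trans) (intro mult_right_mono, auto simp: C_def)
    show "\<exists>t. h t = x \<and> \<bar>t\<bar> \<le> C * norm x ^ CARD('n)" for x
    proof -
      have "12 ^ d * norm x ^ d \<le> C * norm x ^ d" by (intro mult_right_mono) (auto simp: C_def)
      then show ?thesis using onto[of x] unfolding d_def[symmetric] by (blast intro: order_trans)
    qed
  qed
qed

section \<open>Quantiles and couplings\<close>

text \<open>Among the preimages of \<open>x\<close> one of least absolute value \<open>r x\<close>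
  is chosen. Then \<open>r x \<le> a\<close> holds exactly on the image of the compact interval from
  -a to a, a closed set, so \<open>r\<close> is Borel; only the sign remains to be selected.\<close>

lemma measurable_right_inverse:
  fixes h :: "real \<Rightarrow> 'a::euclidean_space" and b :: "'a \<Rightarrow> real"
  assumes cont: "continuous_on UNIV h"
    and onto: "\<And>x. \<exists>t. h t = x \<and> \<bar>t\<bar> \<le> b x"
  obtains s where "s \<in> borel_measurable borel" "\<And>x. h (s x) = x" "\<And>x. \<bar>s x\<bar> \<le> b x"
proof -
  define r where "r x = Inf (abs ` {t. h t = x})" for x
  have r: "\<exists>t. h t = x \<and> r x = \<bar>t\<bar> \<and> (\<forall>u. h u = x \<longrightarrow> \<bar>t\<bar> \<le> \<bar>u\<bar>)" for x
  proof -
    obtain t0 where t0: "h t0 = x" using onto by blast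
    have "closed {t. h t = x}"
      using continuous_closed_vimage[of "{x}" h] cont
      by (auto simp: vimage_def continuous_on_eq_continuous_at)
    then have "compact ({t. h t = x} \<inter> cball 0 \<bar>t0\<bar>)" by (simp add: closed_Int_compact)
    moreover have "t0 \<in> {t. h t = x} \<inter> cball 0 \<bar>t0\<bar>" using t0 by simp
    moreover have "continuous_on ({t. h t = x} \<inter> cball 0 \<bar>t0\<bar>) abs" by (intro continuous_intros)
    ultimately obtain t where "t \<in> {t. h t = x} \<inter> cball 0 \<bar>t0\<bar>"
      "\<forall>u \<in> {t. h t = x} \<inter> cball 0 \<bar>t0\<bar>. \<bar>t\<bar> \<le> \<bar>u\<bar>"
      using continuous_attains_inf[of _ abs] by blast
    then have t: "h t = x" "\<And>u. h u = x \<Longrightarrow> \<bar>u\<bar> \<le> \<bar>t0\<bar> \<Longrightarrow> \<bar>t\<bar> \<le> \<bar>u\<bar>"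
      by auto
    have min: "\<bar>t\<bar> \<le> \<bar>u\<bar>" if "h u = x" for u
      using t(2)[OF that] t(2)[OF t0] by linarith
    have "r x = \<bar>t\<bar>"
      unfolding r_def by (rule cInf_eq_minimum) (use t(1) min in auto)
    then show ?thesis using t(1) min by auto
  qed
  define s where "s x = (if h (r x) = x then r x else - r x)" for x
  have hs: "h (s x) = x" for x
  proof -
    obtain t where "h t = x" "r x = \<bar>t\<bar>" using r by blast
    then show ?thesis by (cases "t \<ge> 0") (auto simp: s_def)
  qed
  have "\<bar>s x\<bar> \<le> b x" for x
  proof -
    obtain t where t: "r x = \<bar>t\<bar>" "\<forall>u. h u = x \<longrightarrow> \<bar>t\<bar> \<le> \<bar>u\<bar>" using r by blast
    then have "\<bar>s x\<bar> = \<bar>t\<bar>" by (auto simp: s_def)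
    then show ?thesis using onto[of x] t(2) by fastforce
  qed
  moreover have "s \<in> borel_measurable borel"
  proof -
    have [measurable]: "h \<in> borel_measurable borel" using cont by (rule borel_measurable_continuous_onI)
    have [measurable]: "r \<in> borel_measurable borel"
      unfolding borel_measurable_iff_le
    proof
      fix a
      have "{x. r x \<le> a} = h ` {-a..a}"
      proof (intro set_eqI iffI)
        fix x assume "x \<in> {x. r x \<le> a}"
        moreover obtain t where "h t = x" "r x = \<bar>t\<bar>" using r by blast
        ultimately show "x \<in> h ` {-a..a}" by (intro image_eqI[of _ _ t]) auto
      next
        fix x assume "x \<in> h ` {-a..a}"
        then obtain u where "h u = x" "\<bar>u\<bar> \<le> a" by auto
        moreover obtain t where "r x = \<bar>t\<bar>" "\<forall>u. h u = x \<longrightarrow> \<bar>t\<bar> \<le> \<bar>u\<bar>" using r by blast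
        ultimately show "x \<in> {x. r x \<le> a}" by fastforce
      qed
      moreover have "compact (h ` {-a..a})"
        by (intro compact_continuous_image continuous_on_subset[OF cont]) auto
      ultimately show "{w \<in> space borel. r w \<le> a} \<in> sets borel"
        by (simp add: compact_imp_closed borel_closed)
    qed
    \<comment> \<open>Writing the test as a vanishing distance makes the case distinction visibly
      measurable.\<close>
    have "s = (\<lambda>x. if dist (h (r x)) x = 0 then r x else - r x)" by (simp add: s_def fun_eq_iff)
    moreover have "\<dots> \<in> borel_measurable borel" by measurable
    ultimately show ?thesis by simp
  qed
  ultimately show thesis using hs that by blast
qed

section \<open>Cells of equal mass and couplings through one uniform variable\<close>

abbreviation uniform01 :: "real measure"
  where "uniform01 \<equiv> restrict_space lborel {0<..<1}"

lemma prob_space_uniform01: "prob_space uniform01"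
  by (auto simp add: emeasure_restrict_space space_restrict_space intro!: prob_spaceI)

lemma space_uniform01: "space uniform01 = {0<..<1}"
  by (simp add: space_restrict_space)

lemma sets_uniform01 [measurable_cong]: "sets uniform01 = sets (restrict_space borel {0<..<1})"
  by (intro sets_restrict_space_cong) simp

text \<open>\<open>G\<close> is the generalized inverse of the distribution function, as in
  Skorohod's representation.\<close>

lemma quantile_representation:
  fixes M :: "real measure"
  assumes "prob_space M" "sets M = sets borel"
  obtains G where "mono_on {0<..<1} G" "G \<in> borel_measurable uniform01"
    "distr uniform01 borel G = M"
proof -
  interpret prob_space M by fact
  interpret cdf_distribution M
    by unfold_locales (use assms sets_eq_imp_space_eq[OF assms(2)] in auto)
  show thesis
    using mono_I measurable_CI distr_I_eq_M by (intro that) (auto simp: measurable_def sets_uniform01)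
qed

text \<open>Cells are left-open and right-closed, and on the open unit interval they are numbered
  from 1 to \<open>N\<close> like the atoms of \<open>empirical\<close>.\<close>

definition cell :: "nat \<Rightarrow> real \<Rightarrow> nat"
  where "cell N u = nat \<lceil>real N * u\<rceil>"

lemma cell_eq_iff:
  assumes "1 \<le> N" "1 \<le> i"
  shows "cell N u = i \<longleftrightarrow> (real i - 1) / N < u \<and> u \<le> i / N"
proof -
  have "cell N u = i \<longleftrightarrow> \<lceil>real N * u\<rceil> = int i" using assms(2) by (auto simp: cell_def)
  also have "\<dots> \<longleftrightarrow> real i - 1 < N * u \<and> N * u \<le> i" by (auto simp: ceiling_eq_iff)
  also have "\<dots> \<longleftrightarrow> (real i - 1) / N < u \<and> u \<le> i / N" using assms(1) by (auto simp: field_simps)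
  finally show ?thesis .
qed

lemma cell_bounds:
  assumes "1 \<le> N" "0 < u" "u < 1"
  shows "1 \<le> cell N u" "cell N u \<le> N"
proof -
  have "0 < real N * u" "real N * u \<le> real N * 1" using assms by (auto intro: mult_left_mono)
  then have "0 < \<lceil>real N * u\<rceil>" "\<lceil>real N * u\<rceil> \<le> int N" unfolding ceiling_le_iff by simp_all
  then show "1 \<le> cell N u" "cell N u \<le> N" unfolding cell_def by linarith+
qed

lemma measurable_cell [measurable]: "cell N \<in> measurable borel (count_space UNIV)"
  unfolding cell_def by measurable

lemma measurable_cell_uniform01: "cell N \<in> measurable uniform01 (count_space UNIV)"
  by (intro measurable_restrict_space1) simp

definition cells :: "nat \<Rightarrow> nat set \<Rightarrow> real set"
  where "cells N I = {u \<in> space uniform01. cell N u \<in> I}"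

lemma sets_cells [measurable]: "cells N I \<in> sets uniform01"
  using measurable_sets[OF measurable_cell_uniform01, of I N]
  by (simp add: cells_def vimage_def Int_def conj_commute)

lemma emeasure_cell:
  assumes "1 \<le> N" "1 \<le> i" "i \<le> N"
  shows "emeasure uniform01 (cells N {i}) = ennreal (1 / N)"
proof -
  have le: "0 \<le> (real i - 1) / N" "real i / N \<le> 1" "(real i - 1) / N \<le> real i / N"
    using assms by (auto simp: field_simps)
  have "emeasure uniform01 (cells N {i})
      = emeasure lborel {u \<in> {0<..<1}. (real i - 1) / N < u \<and> u \<le> i / N}"
    unfolding cells_def singleton_iff space_uniform01 cell_eq_iff[OF assms(1,2)] by (rule emeasure_restrict_space) auto
  \<comment> \<open>The right end point is a null set. Discarding it treats all cells alike: for
    \<open>i = N\<close> it is 1 and lies outside the base space.\<close>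
  also have "\<dots> = emeasure lborel {(real i - 1) / N <..< i / N}"
  proof (rule emeasure_eq_AE)
    show "AE u in lborel. (u \<in> {u \<in> {0<..<1}. (real i - 1) / N < u \<and> u \<le> i / N}) =
        (u \<in> {(real i - 1) / N <..< i / N})"
      using AE_lborel_singleton[of "i / N"] by eventually_elim (use le in auto)
  qed auto
  also have "\<dots> = ennreal (1 / N)"
    using le by (simp add: diff_divide_distrib)
  finally show ?thesis .
qed

lemma distr_cell:
  assumes "1 \<le> N"
  shows "distr uniform01 borel (\<lambda>u. x (cell N u)) = empirical N x"
proof (rule measure_eqI)
  show "sets (distr uniform01 borel (\<lambda>u. x (cell N u))) = sets (empirical N x)"
    using empirical_borel_probs[OF assms, of x] by (simp add: borel_probs_def)
  fix A assume "A \<in> sets (distr uniform01 borel (\<lambda>u. x (cell N u)))"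
  then have A: "A \<in> sets borel" by simp
  have x [measurable]: "(\<lambda>u. x (cell N u)) \<in> measurable uniform01 borel"
    by (rule measurable_compose[OF measurable_cell_uniform01]) simp
  have "(\<lambda>u. x (cell N u)) -` A \<inter> space uniform01 = (\<Union>i\<in>{i \<in> {1..N}. x i \<in> A}. cells N {i})"
    using cell_bounds[OF assms] by (auto simp: cells_def space_uniform01)
  then have "emeasure (distr uniform01 borel (\<lambda>u. x (cell N u))) A
      = emeasure uniform01 (\<Union>i\<in>{i \<in> {1..N}. x i \<in> A}. cells N {i})"
    using A by (simp add: emeasure_distr)
  also have "\<dots> = (\<Sum>i\<in>{i \<in> {1..N}. x i \<in> A}. emeasure uniform01 (cells N {i}))"
    by (intro sum_emeasure[symmetric]) (auto simp: disjoint_family_on_def, auto simp: cells_def)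
  also have "\<dots> = (\<Sum>i\<in>{i \<in> {1..N}. x i \<in> A}. ennreal (1 / N))"
    using assms by (intro sum.cong emeasure_cell) auto
  also have "\<dots> = (\<Sum>i\<in>{1..N}. ennreal (1 / N) * emeasure (return borel (x i)) A)"
    using A by (intro sum.mono_neutral_cong_left) (auto simp: indicator_def)
  also have "\<dots> = emeasure (empirical N x) A"
    by (simp add: emeasure_empirical[OF A] sum_distrib_left)
  finally show "emeasure (distr uniform01 borel (\<lambda>u. x (cell N u))) A = emeasure (empirical N x) A" .
qed

text \<open>Both variables are functions of the same uniform \<open>u\<close>, so their joint law is
  a coupling, and its cost bounds both infima.\<close>

lemma quant_error_le:
  fixes X :: "real \<Rightarrow> 'a::euclidean_space"
  assumes X [measurable]: "X \<in> borel_measurable uniform01" and "1 \<le> N"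
  shows "quant_error N p (distr uniform01 borel X)
    \<le> ennpow (\<integral>\<^sup>+ u. ennreal (norm (X u - x (cell N u)) powr p) \<partial>uniform01) (1 / p)"
proof -
  interpret prob_space uniform01 by (rule prob_space_uniform01)
  have Y [measurable]: "(\<lambda>u. x (cell N u)) \<in> borel_measurable uniform01"
    by (rule measurable_compose[OF measurable_cell_uniform01]) simp
  define \<gamma> where "\<gamma> = distr uniform01 borel (\<lambda>u. (X u, x (cell N u)))"
  have "\<gamma> \<in> borel_probs" unfolding \<gamma>_def borel_probs_def by (auto intro!: prob_space_distr)
  moreover have "distr \<gamma> borel fst = distr uniform01 borel X"
    unfolding \<gamma>_def by (subst distr_distr) (auto simp: comp_def borel_prod[symmetric])
  moreover have "distr \<gamma> borel snd = empirical N x"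
    unfolding \<gamma>_def distr_cell[OF assms(2), symmetric]
    by (subst distr_distr) (auto simp: comp_def borel_prod[symmetric])
  ultimately have "\<gamma> \<in> couplings (distr uniform01 borel X) (empirical N x)"
    by (simp add: couplings_def)
  then have "quant_error N p (distr uniform01 borel X)
      \<le> ennpow (\<integral>\<^sup>+ (x, y). ennreal (norm (x - y) powr p) \<partial>\<gamma>) (1 / p)"
    unfolding quant_error_def wasserstein_def by (meson INF_lower UNIV_I order_trans)
  also have "(\<integral>\<^sup>+ (x, y). ennreal (norm (x - y) powr p) \<partial>\<gamma>)
      = (\<integral>\<^sup>+ u. ennreal (norm (X u - x (cell N u)) powr p) \<partial>uniform01)"
  proof -
    have "(\<lambda>z::'a \<times> 'a. ennreal (norm (fst z - snd z) powr p)) \<in> borel_measurable borel"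
      unfolding borel_prod[symmetric] by measurable
    then show ?thesis
      unfolding \<gamma>_def split_beta' by (subst nn_integral_distr) simp_all
  qed
  finally show ?thesis .
qed

section \<open>Sums of powers of increments\<close>

text \<open>Hoelder's inequality with exponents 1/r and 1/(1 - r): once both sums are normalized to
  1, it follows termwise from the weighted inequality between arithmetic and geometric
  means.\<close>

lemma Hoelder_sum:
  fixes x y :: "'i \<Rightarrow> real"
  assumes "finite A" "\<And>i. i \<in> A \<Longrightarrow> 0 \<le> x i" "\<And>i. i \<in> A \<Longrightarrow> 0 \<le> y i" "0 < r" "r < 1"
  shows "(\<Sum>i\<in>A. x i powr r * y i powr (1 - r)) \<le> sum x A powr r * sum y A powr (1 - r)"
proof (cases "sum x A = 0 \<or> sum y A = 0")
  case True
  then have "(\<forall>i\<in>A. x i = 0) \<or> (\<forall>i\<in>A. y i = 0)"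
    using assms by (simp add: sum_nonneg_eq_0_iff)
  then have "(\<Sum>i\<in>A. x i powr r * y i powr (1 - r)) = 0"
    by (intro sum.neutral) auto
  then show ?thesis by simp
next
  case False
  define X Y where "X = sum x A" and "Y = sum y A"
  have XY: "0 < X" "0 < Y"
    using False assms sum_nonneg[of A x] sum_nonneg[of A y] unfolding X_def Y_def by force+
  have "x i powr r * y i powr (1 - r)
      \<le> (r * (x i / X) + (1 - r) * (y i / Y)) * (X powr r * Y powr (1 - r))" if "i \<in> A" for i
  proof -
    have "(x i / X) powr r * (y i / Y) powr (1 - r) \<le> r * (x i / X) + (1 - r) * (y i / Y)"
    proof (cases "x i = 0 \<or> y i = 0")
      case True
      then show ?thesis using assms that XY by auto
    next
      case False
      then have "0 < x i" "0 < y i" using assms that by force+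
      then show ?thesis using assms XY by (intro Youngs_inequality_0) auto
    qed
    then have "(x i / X) powr r * (y i / Y) powr (1 - r) * (X powr r * Y powr (1 - r))
        \<le> (r * (x i / X) + (1 - r) * (y i / Y)) * (X powr r * Y powr (1 - r))"
      by (intro mult_right_mono) auto
    then show ?thesis using assms that XY by (simp add: powr_divide field_simps)
  qed
  then have "(\<Sum>i\<in>A. x i powr r * y i powr (1 - r))
      \<le> (\<Sum>i\<in>A. (r * (x i / X) + (1 - r) * (y i / Y)) * (X powr r * Y powr (1 - r)))"
    by (rule sum_mono)
  also have "\<dots> = (r * (X / X) + (1 - r) * (Y / Y)) * (X powr r * Y powr (1 - r))"
    by (simp only: X_def Y_def sum.distrib sum_distrib_right[symmetric] sum_distrib_left[symmetric]
        sum_divide_distrib[symmetric])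
  also have "\<dots> = X powr r * Y powr (1 - r)" using XY by simp
  finally show ?thesis unfolding X_def Y_def .
qed

text \<open>Each summand satisfies z^r \<le> z (x + y)^(r - 1), and the right sides add up to the
  claim.\<close>

lemma powr_add_ge:
  fixes x y :: real
  assumes "0 \<le> x" "0 \<le> y" "1 \<le> r"
  shows "x powr r + y powr r \<le> (x + y) powr r"
proof (cases "x + y = 0")
  case False
  have *: "z powr r \<le> z * (x + y) powr (r - 1)" if "0 \<le> z" "z \<le> x + y" for z
  proof (cases "z = 0")
    case False
    then have "z powr r = z * z powr (r - 1)" using that by (simp add: powr_diff)
    also have "\<dots> \<le> z * (x + y) powr (r - 1)"
      using that assms by (intro mult_left_mono powr_mono2) auto
    finally show ?thesis .
  qed simp
  have "x powr r + y powr r \<le> (x + y) * (x + y) powr (r - 1)"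
    using *[of x] *[of y] assms by (simp add: distrib_right)
  also have "\<dots> = (x + y) powr r" using False assms by (simp add: powr_diff)
  finally show ?thesis .
next
  case True
  then have "x = 0" "y = 0" using assms by linarith+
  then show ?thesis by simp
qed

lemma sum_powr_increments_le:
  fixes t :: "nat \<Rightarrow> real"
  assumes "mono_on {1..n} t" "1 \<le> r" "1 \<le> m" "m \<le> n"
  shows "(\<Sum>i=2..m. (t i - t (i - 1)) powr r) \<le> (t m - t 1) powr r"
  using assms(3,4)
proof (induction m rule: dec_induct)
  case (step m)
  have mono: "t i \<le> t j" if "1 \<le> i" "i \<le> j" "j \<le> n" for i j
    using assms(1) that by (auto simp: mono_on_def)
  have "(\<Sum>i=2..Suc m. (t i - t (i - 1)) powr r)
      = (\<Sum>i=2..m. (t i - t (i - 1)) powr r) + (t (Suc m) - t m) powr r"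
    using step by (simp add: sum.atLeast_Suc_atMost_Suc_shift sum.cl_ivl_Suc)
  also have "\<dots> \<le> (t m - t 1) powr r + (t (Suc m) - t m) powr r"
    using step by auto
  also have "\<dots> \<le> ((t m - t 1) + (t (Suc m) - t m)) powr r"
    using mono[of 1 m] mono[of m "Suc m"] step assms(2) by (intro powr_add_ge) auto
  finally show ?case by simp
qed simp

text \<open>The antiderivative of $(1 + x)^{-a}$ that vanishes at 0.\<close>

definition Phi :: "real \<Rightarrow> real \<Rightarrow> real"
  where "Phi a x = (if a = 1 then ln (1 + x) else ((1 + x) powr (1 - a) - 1) / (1 - a))"

lemma Phi_0 [simp]: "Phi a 0 = 0"
  by (simp add: Phi_def)

lemma Phi_deriv:
  assumes "0 \<le> x"
  shows "(Phi a has_real_derivative (1 + x) powr (- a)) (at x)"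
proof (cases "a = 1")
  case True
  have "((\<lambda>x. ln (1 + x)) has_real_derivative (1 + x) powr (- 1)) (at x)"
    using assms by (auto intro!: derivative_eq_intros simp: powr_minus_divide)
  then show ?thesis using True by (simp add: Phi_def[abs_def])
next
  case False
  have "((\<lambda>x. ((1 + x) powr (1 - a) - 1) / (1 - a)) has_real_derivative (1 + x) powr (- a)) (at x)"
  proof -
    have "((\<lambda>x. 1 + x) has_real_derivative 1) (at x)" by (auto intro!: derivative_eq_intros)
    from DERIV_fun_powr[OF this, of "1 - a"] assms
    have "((\<lambda>x. (1 + x) powr (1 - a)) has_real_derivative (1 - a) * (1 + x) powr (- a)) (at x)"
      by simp
    from DERIV_cdivide[OF DERIV_diff[OF this DERIV_const[of 1]], of "1 - a"] False
    show ?thesis by simp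
  qed
  then show ?thesis using False by (simp add: Phi_def[abs_def])
qed

lemma Phi_diff_ge:
  assumes "0 \<le> x" "x \<le> y" "0 \<le> a"
  shows "(y - x) * (1 + y) powr (- a) \<le> Phi a y - Phi a x"
proof (cases "x = y")
  case False
  with assms have "x < y" by simp
  then obtain z where z: "x < z" "z < y" "Phi a y - Phi a x = (y - x) * (1 + z) powr (- a)"
    using MVT2[of x y "Phi a" "\<lambda>x. (1 + x) powr (- a)"] Phi_deriv assms(1) by force
  have "(1 + y) powr (- a) \<le> (1 + z) powr (- a)"
    using z assms by (intro powr_mono2') auto
  then show ?thesis using z \<open>x < y\<close> by simp
qed simp

lemma Phi_mono:
  assumes "0 \<le> x" "x \<le> y" "0 \<le> a"
  shows "Phi a x \<le> Phi a y"
proof -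
  have "0 \<le> (y - x) * (1 + y) powr (- a)" using assms by simp
  then show ?thesis using Phi_diff_ge[OF assms] by linarith
qed

text \<open>The odd extension of \<open>Phi a\<close> is a primitive of (1 + |z|)^(-a) on the whole
  line, and the weight on the left is the smallest value of this function between \<open>x\<close>
  and \<open>y\<close>.\<close>

lemma weighted_increment_le:
  fixes x y a :: real
  assumes "x \<le> y" "0 \<le> a"
  shows "(y - x) * (1 + max \<bar>x\<bar> \<bar>y\<bar>) powr (- a)
    \<le> (sgn y * Phi a \<bar>y\<bar>) - (sgn x * Phi a \<bar>x\<bar>)"
proof -
  consider "0 \<le> x" | "y \<le> 0" | "x < 0" "0 < y" by linarith
  then show ?thesis
  proof cases
    case 1
    have "sgn z * Phi a \<bar>z\<bar> = Phi a z" if "0 \<le> z" for z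
      using that by (cases "z = 0") (auto simp: sgn_if)
    then have e: "sgn x * Phi a \<bar>x\<bar> = Phi a x" "sgn y * Phi a \<bar>y\<bar> = Phi a y"
      using 1 assms by auto
    have m: "max \<bar>x\<bar> \<bar>y\<bar> = y" using 1 assms by simp
    show ?thesis unfolding e m using 1 Phi_diff_ge[of x y a] assms by simp
  next
    case 2
    have "sgn z * Phi a \<bar>z\<bar> = - Phi a (- z)" if "z \<le> 0" for z
      using that by (cases "z = 0") (auto simp: sgn_if)
    then have e: "sgn x * Phi a \<bar>x\<bar> = - Phi a (- x)" "sgn y * Phi a \<bar>y\<bar> = - Phi a (- y)"
      using 2 assms by auto
    have m: "max \<bar>x\<bar> \<bar>y\<bar> = - x" using 2 assms by simp
    show ?thesis unfolding e m using 2 Phi_diff_ge[of "- y" "- x" a] assms by simp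
  next
    case 3
    define T where "T = max \<bar>x\<bar> \<bar>y\<bar>"
    have "z * (1 + T) powr (- a) \<le> Phi a z" if "0 \<le> z" "z \<le> T" for z
    proof -
      have "z * (1 + T) powr (- a) \<le> z * (1 + z) powr (- a)"
        using that assms by (intro mult_left_mono powr_mono2') auto
      then show ?thesis using Phi_diff_ge[of 0 z a] that assms by simp
    qed
    from this[of y] this[of "- x"] show ?thesis
      unfolding T_def[symmetric] using 3 by (simp add: left_diff_distrib T_def)
  qed
qed

text \<open>Hoelder's inequality with weights $w_i = (1 + T_i)^{-a}$, where $a = \sigma (1 - r) / r$ is
  chosen such that $w_i^{-r/(1-r)}$ is a $\sigma$-th moment, while $\sum_i w_i \Delta_i$ is bounded
  by a telescoping sum.\<close>

lemma sum_powr_increments_lt1: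
  fixes t :: "nat \<Rightarrow> real"
  assumes mono: "mono_on {1..n} t" and r: "0 < r" "r < 1" and "0 < \<sigma>"
    and R: "\<And>i. i \<in> {1..n} \<Longrightarrow> \<bar>t i\<bar> \<le> R"
    and S: "(\<Sum>i=1..n. \<bar>t i\<bar> powr \<sigma>) \<le> S"
  shows "(\<Sum>i=2..n. (t i - t (i - 1)) powr r)
    \<le> (2 * Phi (\<sigma> * (1 - r) / r) R) powr r * (2 powr \<sigma> * (n + 2 * S)) powr (1 - r)"
proof (cases "2 \<le> n")
  case True
  define a where "a = \<sigma> * (1 - r) / r"
  have a: "0 \<le> a" using assms by (simp add: a_def)
  define T where "T i = max \<bar>t (i - 1)\<bar> \<bar>t i\<bar>" for i
  have T0: "0 \<le> T i" for i by (simp add: T_def)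
  have mono': "t (i - 1) \<le> t i" if "i \<in> {2..n}" for i
  proof -
    have "i - 1 \<in> {1..n}" "i \<in> {1..n}" "i - 1 \<le> i" using that by auto
    then show ?thesis using mono by (auto simp: mono_on_def)
  qed
  have R0: "0 \<le> R" using R[of 1] True by force
  define x where "x i = (t i - t (i - 1)) * (1 + T i) powr (- a)" for i
  define y where "y i = (1 + T i) powr \<sigma>" for i
  have x0: "0 \<le> x i" if "i \<in> {2..n}" for i using mono'[OF that] by (simp add: x_def)
  have y0: "0 \<le> y i" for i by (simp add: y_def)
  have "(\<Sum>i=2..n. (t i - t (i - 1)) powr r) = (\<Sum>i=2..n. x i powr r * y i powr (1 - r))"
  proof (rule sum.cong[OF refl])
    fix i assume i: "i \<in> {2..n}"
    have "x i powr r * y i powr (1 - r)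
        = (t i - t (i - 1)) powr r * ((1 + T i) powr (- a * r) * (1 + T i) powr (\<sigma> * (1 - r)))"
      using mono'[OF i] by (simp add: x_def y_def powr_mult powr_powr)
    also have "(1 + T i) powr (- a * r) * (1 + T i) powr (\<sigma> * (1 - r)) = 1"
      using T0[of i] r by (simp add: a_def flip: powr_add)
    finally show "(t i - t (i - 1)) powr r = x i powr r * y i powr (1 - r)" by simp
  qed
  also have "\<dots> \<le> sum x {2..n} powr r * sum y {2..n} powr (1 - r)"
    by (rule Hoelder_sum) (use x0 y0 r in auto)
  also have "\<dots> \<le> (2 * Phi a R) powr r * (2 powr \<sigma> * (n + 2 * S)) powr (1 - r)"
  proof (intro mult_mono powr_mono2)
    define \<psi> where "\<psi> i = sgn (t i) * Phi a \<bar>t i\<bar>" for i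
    have Phi_le: "\<bar>\<psi> i\<bar> \<le> Phi a R" if "i \<in> {1..n}" for i
    proof -
      have "0 \<le> Phi a \<bar>t i\<bar>" using Phi_mono[of 0 "\<bar>t i\<bar>" a] a by simp
      then have "\<bar>\<psi> i\<bar> \<le> Phi a \<bar>t i\<bar>" by (auto simp: \<psi>_def sgn_if)
      also have "\<dots> \<le> Phi a R" using R[OF that] a by (intro Phi_mono) auto
      finally show ?thesis .
    qed
    have "sum x {2..n} \<le> (\<Sum>i=2..n. \<psi> i - \<psi> (i - 1))"
      unfolding x_def T_def \<psi>_def using mono' a by (intro sum_mono weighted_increment_le) auto
    also have "\<dots> = \<psi> n - \<psi> 1"
      using sum_telescope''[of 1 n \<psi>] True by (simp add: numeral_2_eq_2)
    also have "\<dots> \<le> 2 * Phi a R" using Phi_le[of n] Phi_le[of 1] True by force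
    finally show "sum x {2..n} \<le> 2 * Phi a R" .
    \<comment> \<open>The maximum is replaced by a sum; every node belongs to at most two
      increments, hence the \<open>2 * S\<close>.\<close>
    have "(1 + T i) powr \<sigma> \<le> 2 powr \<sigma> * (1 + (\<bar>t (i - 1)\<bar> powr \<sigma> + \<bar>t i\<bar> powr \<sigma>))" for i
    proof -
      have "(1 + T i) powr \<sigma> \<le> (2 * max 1 (T i)) powr \<sigma>"
        using assms T0[of i] by (intro powr_mono2) auto
      also have "\<dots> = 2 powr \<sigma> * max 1 (T i) powr \<sigma>" by (simp add: powr_mult)
      also have "\<dots> \<le> 2 powr \<sigma> * (1 + (\<bar>t (i - 1)\<bar> powr \<sigma> + \<bar>t i\<bar> powr \<sigma>))"
        by (intro mult_left_mono) (auto simp: max_def T_def)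
      finally show ?thesis .
    qed
    then have "sum y {2..n} \<le> (\<Sum>i=2..n. 2 powr \<sigma> * (1 + (\<bar>t (i - 1)\<bar> powr \<sigma> + \<bar>t i\<bar> powr \<sigma>)))"
      unfolding y_def by (intro sum_mono)
    also have "\<dots> = 2 powr \<sigma> * (real (n - 1)
        + ((\<Sum>i=2..n. \<bar>t (i - 1)\<bar> powr \<sigma>) + (\<Sum>i=2..n. \<bar>t i\<bar> powr \<sigma>)))"
      by (simp add: sum.distrib flip: sum_distrib_left)
    also have "(\<Sum>i=2..n. \<bar>t (i - 1)\<bar> powr \<sigma>) = (\<Sum>i=1..n-1. \<bar>t i\<bar> powr \<sigma>)"
      using True by (intro sum.reindex_bij_witness[of _ Suc "\<lambda>i. i - 1"]) auto
    also have "2 powr \<sigma> * (real (n - 1) + ((\<Sum>i=1..n-1. \<bar>t i\<bar> powr \<sigma>) + (\<Sum>i=2..n. \<bar>t i\<bar> powr \<sigma>)))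
        \<le> 2 powr \<sigma> * (n + (S + S))"
    proof (intro mult_left_mono add_mono)
      show "(\<Sum>i=1..n-1. \<bar>t i\<bar> powr \<sigma>) \<le> S" "(\<Sum>i=2..n. \<bar>t i\<bar> powr \<sigma>) \<le> S"
        by (rule order_trans[OF sum_mono2 S]; auto)+
    qed auto
    finally show "sum y {2..n} \<le> 2 powr \<sigma> * (n + 2 * S)" by simp
  qed (use x0 y0 r in \<open>auto intro!: sum_nonneg\<close>)
  finally show ?thesis unfolding a_def .
qed simp

section \<open>Quantization of a quantile function\<close>

lemma nn_integral_cells_sum:
  assumes "finite I" and [measurable]: "f \<in> borel_measurable uniform01"
  shows "(\<Sum>i\<in>I. \<integral>\<^sup>+u\<in>cells N {i}. f u \<partial>uniform01) = (\<integral>\<^sup>+u\<in>cells N I. f u \<partial>uniform01)"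
proof -
  have "(\<Sum>i\<in>I. \<integral>\<^sup>+u\<in>cells N {i}. f u \<partial>uniform01)
      = (\<integral>\<^sup>+u. (\<Sum>i\<in>I. f u * indicator (cells N {i}) u) \<partial>uniform01)"
    by (intro nn_integral_sum[symmetric]) auto
  also have "\<dots> = (\<integral>\<^sup>+u\<in>cells N I. f u \<partial>uniform01)"
  proof (rule nn_integral_cong)
    fix u assume "u \<in> space uniform01"
    then have "(\<Sum>i\<in>I. f u * indicator (cells N {i}) u) = (\<Sum>i\<in>I. if i = cell N u then f u else 0)"
      by (intro sum.cong) (auto simp: cells_def)
    also have "\<dots> = f u * indicator (cells N I) u"
      using assms(1) \<open>u \<in> space uniform01\<close> by (simp add: sum.delta' cells_def indicator_def)
    finally show "(\<Sum>i\<in>I. f u * indicator (cells N {i}) u) = f u * indicator (cells N I) u" .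
  qed
  finally show ?thesis .
qed

lemma nn_integral_cell_const:
  assumes "1 \<le> i" "i \<le> N" "0 \<le> c"
  shows "(\<integral>\<^sup>+u\<in>cells N {i}. ennreal c \<partial>uniform01) = ennreal (c / N)"
proof -
  have "(\<integral>\<^sup>+u\<in>cells N {i}. ennreal c \<partial>uniform01) = ennreal c * ennreal (1 / N)"
    using assms by (subst nn_integral_cmult_indicator) (auto simp: emeasure_cell)
  also have "\<dots> = ennreal (c / N)" using assms(3) by (simp flip: ennreal_mult)
  finally show ?thesis .
qed

text \<open>Only an inequality, since for \<open>N = 1\<close> the two end cells are the
  same.\<close>

lemma nn_integral_end_cells_const_le:
  assumes "1 \<le> N" "0 \<le> c"
  shows "(\<integral>\<^sup>+u\<in>cells N {1, N}. ennreal c \<partial>uniform01) \<le> ennreal (2 * (c / N))"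
proof -
  have "(\<integral>\<^sup>+u\<in>cells N {1, N}. ennreal c \<partial>uniform01)
      = (\<Sum>i\<in>{1, N}. \<integral>\<^sup>+u\<in>cells N {i}. ennreal c \<partial>uniform01)"
    by (intro nn_integral_cells_sum[symmetric]) auto
  also have "\<dots> = (\<Sum>i\<in>{1, N}. ennreal (c / N))"
    using assms by (intro sum.cong nn_integral_cell_const) auto
  also have "\<dots> = of_nat (card {1, N}) * ennreal (c / N)" by simp
  also have "\<dots> \<le> of_nat 2 * ennreal (c / N)"
    by (intro mult_right_mono) (auto simp: card_insert_if)
  also have "\<dots> = ennreal (2 * (c / N))"
    using assms ennreal_mult[of 2 "c / N"] by simp
  finally show ?thesis .
qed

lemma ennpow_mono:
  assumes "x \<le> y" "0 \<le> a"
  shows "ennpow x a \<le> ennpow y a"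
proof (cases "y = \<infinity>")
  case False
  then have "x < \<infinity>" "y < \<infinity>" using assms(1) by (auto simp: less_top[symmetric] top_unique)
  then have "enn2real x \<le> enn2real y" using assms(1) by (intro enn2real_mono) auto
  then show ?thesis
    using False \<open>x < \<infinity>\<close> assms(2) by (auto simp: ennpow_def intro!: ennreal_leI powr_mono2)
qed (simp add: ennpow_def)

lemma ennpow_ennreal: "0 \<le> x \<Longrightarrow> ennpow (ennreal x) a = ennreal (x powr a)"
  by (simp add: ennpow_def)

text \<open>Bounds the cost of quantizing the law of $G$ at its $i/N$-quantiles with exponent $r$;
  the mass of the first and the last cell is moved to 0.\<close>

definition quantile_cost :: "(real \<Rightarrow> real) \<Rightarrow> nat \<Rightarrow> real \<Rightarrow> ennreal"
  where "quantile_cost G N r =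
    ennreal ((\<Sum>i=2..N-1. (G (real i / N) - G (real (i - 1) / N)) powr r) / N)
    + (\<integral>\<^sup>+u\<in>cells N {1, N}. ennreal (\<bar>G u\<bar> powr r) \<partial>uniform01)"

section \<open>Moment estimates at the quantile nodes\<close>

locale quantile_function =
  fixes G :: "real \<Rightarrow> real"
  assumes mono_G: "mono_on {0<..<1} G"
    and measurable_G [measurable]: "G \<in> borel_measurable uniform01"
begin

text \<open>Only the indices from 1 to \<open>N - 1\<close> are used: monotonicity of
  \<open>G\<close> is known on the open unit interval alone.\<close>

definition t :: "nat \<Rightarrow> nat \<Rightarrow> real"
  where "t N i = G (real i / real N)"

lemma quantile_cost_eq: "quantile_cost G N r =
    ennreal ((\<Sum>i=2..N-1. (t N i - t N (i - 1)) powr r) / N)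
    + (\<integral>\<^sup>+u\<in>cells N {1, N}. ennreal (\<bar>G u\<bar> powr r) \<partial>uniform01)"
  by (simp add: quantile_cost_def t_def)

lemma mono_on_t: "mono_on {1..N - 1} (t N)"
proof (rule mono_onI)
  fix i j assume ij: "i \<in> {1..N - 1}" "j \<in> {1..N - 1}" "i \<le> j"
  then have "real i / N \<in> {0<..<1}" "real j / N \<in> {0<..<1}" "real i / N \<le> real j / N"
    by (auto simp: field_simps)
  then show "t N i \<le> t N j" unfolding t_def using mono_G by (auto simp: mono_on_def)
qed

lemma t_le_G:
  assumes "1 \<le> i" "i < j" "u \<in> cells N {j}" "i < N"
  shows "t N i \<le> G u"
proof -
  have u: "0 < u" "u < 1" "cell N u = j" using assms by (auto simp: cells_def space_uniform01)
  have "(real j - 1) / N < u" using cell_eq_iff[of N j u] u assms by auto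
  moreover have "real i / N \<le> (real j - 1) / N" using assms by (intro divide_right_mono) auto
  moreover have "real i / N \<in> {0<..<1}" using assms by auto
  ultimately show ?thesis unfolding t_def using mono_G u by (auto simp: mono_on_def)
qed

lemma G_le_t:
  assumes "1 \<le> j" "j \<le> i" "u \<in> cells N {j}" "i < N"
  shows "G u \<le> t N i"
proof -
  have u: "0 < u" "u < 1" "cell N u = j" using assms by (auto simp: cells_def space_uniform01)
  have "u \<le> real j / N" using cell_eq_iff[of N j u] u assms by auto
  moreover have "real j / N \<le> real i / N" using assms by (intro divide_right_mono) auto
  moreover have "real i / N \<in> {0<..<1}" using assms by auto
  ultimately show ?thesis unfolding t_def using mono_G u by (auto simp: mono_on_def)
qed

text \<open>On a cell to the right of a nonnegative quantile, or to the left of a negative one,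
  \<open>G\<close> is at least as large in absolute value. This is Chebyshev's inequality with the
  mass 1/N of one cell.\<close>

lemma t_powr_le_cell:
  assumes "1 \<le> i" "i < N" "1 \<le> j" "j \<le> N" "0 \<le> \<sigma>" "if 0 \<le> t N i then i < j else j \<le> i"
  shows "ennreal (\<bar>t N i\<bar> powr \<sigma> / N) \<le> (\<integral>\<^sup>+u\<in>cells N {j}. ennreal (\<bar>G u\<bar> powr \<sigma>) \<partial>uniform01)"
proof -
  have "ennreal (\<bar>t N i\<bar> powr \<sigma> / N) = (\<integral>\<^sup>+u\<in>cells N {j}. ennreal (\<bar>t N i\<bar> powr \<sigma>) \<partial>uniform01)"
    using assms by (simp add: nn_integral_cell_const)
  also have "\<dots> \<le> (\<integral>\<^sup>+u\<in>cells N {j}. ennreal (\<bar>G u\<bar> powr \<sigma>) \<partial>uniform01)"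
  proof (intro nn_integral_mono)
    fix u
    have "\<bar>t N i\<bar> \<le> \<bar>G u\<bar>" if "u \<in> cells N {j}"
      using assms(6) t_le_G[OF assms(1) _ that assms(2)] G_le_t[OF assms(3) _ that assms(2)]
      by (cases "0 \<le> t N i") auto
    then show "ennreal (\<bar>t N i\<bar> powr \<sigma>) * indicator (cells N {j}) u
        \<le> ennreal (\<bar>G u\<bar> powr \<sigma>) * indicator (cells N {j}) u"
      using assms(5) by (auto simp: indicator_def intro!: ennreal_leI powr_mono2)
  qed
  finally show ?thesis .
qed

text \<open>The outermost cell on the side of the sign of the node lies beyond it, so the moment
  \<kappa> of the end cells alone controls every node. Smallness of \<kappa> enters the cost of the
  increments here.\<close>

lemma abs_t_le:
  assumes "1 \<le> i" "i < N" "0 < \<sigma>" "0 \<le> \<kappa>"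
    and tail: "(\<integral>\<^sup>+u\<in>cells N {1, N}. ennreal (\<bar>G u\<bar> powr \<sigma>) \<partial>uniform01) \<le> ennreal \<kappa>"
  shows "\<bar>t N i\<bar> \<le> (N * \<kappa>) powr (1 / \<sigma>)"
proof -
  define j where "j = (if 0 \<le> t N i then N else 1)"
  have "ennreal (\<bar>t N i\<bar> powr \<sigma> / N) \<le> (\<integral>\<^sup>+u\<in>cells N {j}. ennreal (\<bar>G u\<bar> powr \<sigma>) \<partial>uniform01)"
    using assms by (intro t_powr_le_cell) (auto simp: j_def)
  also have "\<dots> \<le> (\<integral>\<^sup>+u\<in>cells N {1, N}. ennreal (\<bar>G u\<bar> powr \<sigma>) \<partial>uniform01)"
    by (intro nn_integral_mono) (auto simp: indicator_def cells_def j_def)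
  also note tail
  finally have "\<bar>t N i\<bar> powr \<sigma> / N \<le> \<kappa>" using assms by (simp add: ennreal_le_iff)
  then have "\<bar>t N i\<bar> powr \<sigma> \<le> N * \<kappa>" using assms by (simp add: field_simps)
  then have "(\<bar>t N i\<bar> powr \<sigma>) powr (1 / \<sigma>) \<le> (N * \<kappa>) powr (1 / \<sigma>)"
    using assms by (intro powr_mono2) auto
  then show ?thesis using assms by (simp add: powr_powr)
qed

text \<open>A nonnegative node is charged to the cell on its right, a negative one to the cell on
  its left. Each cell is charged at most twice, hence the factor 2.\<close>

lemma sum_t_powr_le:
  assumes "1 \<le> N" "0 < \<sigma>" "0 \<le> M"
    and total: "(\<integral>\<^sup>+u. ennreal (\<bar>G u\<bar> powr \<sigma>) \<partial>uniform01) \<le> ennreal M"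
  shows "(\<Sum>i=1..N-1. \<bar>t N i\<bar> powr \<sigma>) \<le> 2 * real N * M"
proof -
  let ?c = "\<lambda>I. \<integral>\<^sup>+u\<in>cells N I. ennreal (\<bar>G u\<bar> powr \<sigma>) \<partial>uniform01"
  have c: "?c I \<le> ennreal M" for I
    by (rule order_trans[OF nn_integral_mono total]) (auto simp: indicator_def)
  have "ennreal (\<Sum>i=1..N-1. \<bar>t N i\<bar> powr \<sigma> / N) = (\<Sum>i=1..N-1. ennreal (\<bar>t N i\<bar> powr \<sigma> / N))"
    by (intro sum_ennreal[symmetric]) auto
  also have "\<dots> \<le> (\<Sum>i=1..N-1. ?c {i} + ?c {Suc i})"
  proof (rule sum_mono)
    fix i assume i: "i \<in> {1..N-1}"
    show "ennreal (\<bar>t N i\<bar> powr \<sigma> / N) \<le> ?c {i} + ?c {Suc i}"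
    proof (cases "0 \<le> t N i")
      case True
      then have "ennreal (\<bar>t N i\<bar> powr \<sigma> / N) \<le> ?c {Suc i}"
        using i assms by (intro t_powr_le_cell) auto
      then show ?thesis by (simp add: add_increasing)
    next
      case False
      then have "ennreal (\<bar>t N i\<bar> powr \<sigma> / N) \<le> ?c {i}"
        using i assms by (intro t_powr_le_cell) auto
      then show ?thesis by (simp add: add_increasing2)
    qed
  qed
  also have "\<dots> = ?c {1..N-1} + (\<Sum>i\<in>Suc ` {1..N-1}. ?c {i})"
    by (subst sum.reindex) (auto simp: sum.distrib nn_integral_cells_sum)
  also have "(\<Sum>i\<in>Suc ` {1..N-1}. ?c {i}) = ?c (Suc ` {1..N-1})"
    by (intro nn_integral_cells_sum) auto
  also have "?c {1..N-1} + \<dots> \<le> ennreal M + ennreal M"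
    by (intro add_mono c)
  also have "\<dots> = ennreal (2 * M)" using assms by (simp flip: ennreal_plus)
  finally have "(\<Sum>i=1..N-1. \<bar>t N i\<bar> powr \<sigma> / N) \<le> 2 * M"
    using assms by (simp add: ennreal_le_iff)
  then show ?thesis
    using assms by (simp add: field_simps flip: sum_divide_distrib)
qed

text \<open>Values below \<open>K\<close> contribute at most \<open>K powr r\<close> each, larger
  ones are absorbed by the higher moment. At \<open>K = (N * \<kappa>) powr (1 / \<sigma>)\<close>
  both parts have the same size; the 3 counts two cells for the first part and one term for the
  second.\<close>

lemma tail_powr_le:
  assumes "1 \<le> N" "0 < r" "r < \<sigma>" "0 < \<kappa>"
    and tail: "(\<integral>\<^sup>+u\<in>cells N {1, N}. ennreal (\<bar>G u\<bar> powr \<sigma>) \<partial>uniform01) \<le> ennreal \<kappa>"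
  shows "(\<integral>\<^sup>+u\<in>cells N {1, N}. ennreal (\<bar>G u\<bar> powr r) \<partial>uniform01)
    \<le> ennreal (3 * (N powr (r / \<sigma> - 1) * \<kappa> powr (r / \<sigma>)))"
proof -
  define K where "K = (N * \<kappa>) powr (1 / \<sigma>)"
  have K: "0 < K" using assms by (simp add: K_def)
  have le: "x powr r \<le> K powr r + K powr (r - \<sigma>) * x powr \<sigma>" if "0 \<le> x" for x
  proof (cases "x \<le> K")
    case True
    then have "x powr r \<le> K powr r" using that assms by (intro powr_mono2) auto
    then show ?thesis by (simp add: add_increasing2)
  next
    case False
    then have "x powr r = x powr (r - \<sigma>) * x powr \<sigma>" using K by (simp flip: powr_add)
    also have "\<dots> \<le> K powr (r - \<sigma>) * x powr \<sigma>"
      using False K assms by (intro mult_right_mono powr_mono2') auto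
    finally show ?thesis by (simp add: add_increasing)
  qed
  have "(\<integral>\<^sup>+u\<in>cells N {1, N}. ennreal (\<bar>G u\<bar> powr r) \<partial>uniform01)
      \<le> (\<integral>\<^sup>+u. ennreal (K powr r) * indicator (cells N {1, N}) u
          + ennreal (K powr (r - \<sigma>)) * (ennreal (\<bar>G u\<bar> powr \<sigma>) * indicator (cells N {1, N}) u) \<partial>uniform01)"
    using le by (intro nn_integral_mono)
      (auto simp: indicator_def simp flip: ennreal_mult' ennreal_plus intro!: ennreal_leI)
  also have "\<dots> = (\<integral>\<^sup>+u\<in>cells N {1, N}. ennreal (K powr r) \<partial>uniform01)
      + ennreal (K powr (r - \<sigma>)) * (\<integral>\<^sup>+u\<in>cells N {1, N}. ennreal (\<bar>G u\<bar> powr \<sigma>) \<partial>uniform01)"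
    by (subst nn_integral_add) (auto simp: nn_integral_cmult)
  also have "\<dots> \<le> ennreal (2 * (K powr r / N)) + ennreal (K powr (r - \<sigma>)) * ennreal \<kappa>"
  proof (intro add_mono mult_left_mono tail)
    show "(\<integral>\<^sup>+u\<in>cells N {1, N}. ennreal (K powr r) \<partial>uniform01) \<le> ennreal (2 * (K powr r / N))"
      using assms by (intro nn_integral_end_cells_const_le) auto
  qed auto
  also have "\<dots> = ennreal (2 * (K powr r / N) + K powr (r - \<sigma>) * \<kappa>)"
    using assms by (simp flip: ennreal_mult' ennreal_plus)
  also have "K powr r / N = N powr (r / \<sigma> - 1) * \<kappa> powr (r / \<sigma>)"
    using assms by (simp add: K_def powr_powr powr_mult powr_diff)
  also have "K powr (r - \<sigma>) * \<kappa> = N powr (r / \<sigma> - 1) * \<kappa> powr (r / \<sigma>)"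
  proof -
    have "K powr (r - \<sigma>) = (N * \<kappa>) powr (r / \<sigma> - 1)"
      using assms by (simp add: K_def powr_powr diff_divide_distrib)
    then show ?thesis using assms by (simp add: powr_mult powr_diff)
  qed
  finally show ?thesis by (simp add: algebra_simps)
qed

text \<open>In an inner cell \<open>G\<close> differs from its right end value by at most the
  increment across the cell; in an end cell, where \<open>G\<close> may be unbounded, it is compared
  with 0. The curve turns these distances into costs with exponent \<open>b * p\<close>.\<close>

lemma quant_error_Hoelder_le:
  fixes h :: "real \<Rightarrow> 'a::euclidean_space"
  assumes h: "\<And>x y. norm (h x - h y) \<le> C * \<bar>x - y\<bar> powr b" and "continuous_on UNIV h"
    and "0 < C" "0 < b" "0 < p" "1 \<le> N"
  shows "quant_error N p (distr uniform01 borel (h \<circ> G))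
    \<le> ennpow (ennreal (C powr p) * quantile_cost G N (b * p)) (1 / p)"
proof -
  have [measurable]: "h \<in> borel_measurable borel"
    using assms(2) by (rule borel_measurable_continuous_onI)
  \<comment> \<open>For \<open>N \<le> 2\<close> there are no inner cells, and all mass goes to
    \<open>h 0\<close>.\<close>
  define x where "x i = (if i \<in> {2..N-1} then h (t N i) else h 0)" for i
  have pow: "ennreal (norm (h y - h z) powr p) \<le> ennreal (C powr p) * ennreal (c powr (b * p))"
    if "\<bar>y - z\<bar> \<le> c" for y z c
  proof -
    have "norm (h y - h z) powr p \<le> (C * c powr b) powr p"
    proof (intro powr_mono2)
      have "\<bar>y - z\<bar> powr b \<le> c powr b" using that assms by (intro powr_mono2) auto
      then show "norm (h y - h z) \<le> C * c powr b"
        using h[of y z] assms(3) by (meson less_imp_le mult_left_mono order_trans)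
    qed (use assms in auto)
    also have "\<dots> = C powr p * c powr (b * p)" using assms by (simp add: powr_mult powr_powr)
    finally show ?thesis by (simp add: ennreal_leI flip: ennreal_mult')
  qed
  have "(\<integral>\<^sup>+u. ennreal (norm ((h \<circ> G) u - x (cell N u)) powr p) \<partial>uniform01)
      \<le> (\<integral>\<^sup>+u. ennreal (C powr p) *
          ((\<Sum>i=2..N-1. ennreal ((t N i - t N (i - 1)) powr (b * p)) * indicator (cells N {i}) u)
          + ennreal (\<bar>G u\<bar> powr (b * p)) * indicator (cells N {1, N}) u) \<partial>uniform01)"
  proof (rule nn_integral_mono)
    fix u assume u: "u \<in> space uniform01"
    define i where "i = cell N u"
    have i: "1 \<le> i" "i \<le> N"
      using cell_bounds[OF assms(6)] u by (auto simp: i_def space_uniform01)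
    have ui: "u \<in> cells N {i}" using u by (simp add: cells_def i_def)
    show "ennreal (norm ((h \<circ> G) u - x (cell N u)) powr p) \<le> ennreal (C powr p) *
          ((\<Sum>i=2..N-1. ennreal ((t N i - t N (i - 1)) powr (b * p)) * indicator (cells N {i}) u)
          + ennreal (\<bar>G u\<bar> powr (b * p)) * indicator (cells N {1, N}) u)"
    proof (cases "i \<in> {2..N-1}")
      case True
      have "\<bar>G u - t N i\<bar> \<le> t N i - t N (i - 1)"
        using t_le_G[of "i - 1" i u N] G_le_t[of i i u N] ui True by auto
      from pow[OF this] have "ennreal (norm ((h \<circ> G) u - x (cell N u)) powr p)
          \<le> ennreal (C powr p) * ennreal ((t N i - t N (i - 1)) powr (b * p))"
        using True by (simp add: x_def flip: i_def)
      also have "ennreal ((t N i - t N (i - 1)) powr (b * p))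
          = (\<Sum>j\<in>{i}. ennreal ((t N j - t N (j - 1)) powr (b * p)) * indicator (cells N {j}) u)"
        using ui by simp
      also have "\<dots> \<le> (\<Sum>j=2..N-1. ennreal ((t N j - t N (j - 1)) powr (b * p)) * indicator (cells N {j}) u)"
        using True by (intro sum_mono2) auto
      finally show ?thesis
        by (rule order_trans) (intro mult_left_mono; simp add: add_increasing2)+
    next
      case False
      then have u': "u \<in> cells N {1, N}" using ui i by (auto simp: cells_def)
      have "ennreal (norm ((h \<circ> G) u - x (cell N u)) powr p)
          \<le> ennreal (C powr p) * ennreal (\<bar>G u\<bar> powr (b * p))"
      proof -
        have "x i = h 0" using False by (auto simp: x_def)
        then show ?thesis using pow[of "G u" 0 "\<bar>G u\<bar>"] by (simp flip: i_def)
      qed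
      also have "ennreal (\<bar>G u\<bar> powr (b * p))
          = ennreal (\<bar>G u\<bar> powr (b * p)) * indicator (cells N {1, N}) u"
        using u' by simp
      also have "ennreal (C powr p) * \<dots> \<le> ennreal (C powr p) *
          ((\<Sum>i=2..N-1. ennreal ((t N i - t N (i - 1)) powr (b * p)) * indicator (cells N {i}) u)
          + ennreal (\<bar>G u\<bar> powr (b * p)) * indicator (cells N {1, N}) u)"
        by (intro mult_left_mono add_increasing[OF _ order_refl] zero_le)
      finally show ?thesis .
    qed
  qed
  also have "\<dots> = ennreal (C powr p) *
        ((\<Sum>i=2..N-1. \<integral>\<^sup>+u\<in>cells N {i}. ennreal ((t N i - t N (i - 1)) powr (b * p)) \<partial>uniform01) +
         (\<integral>\<^sup>+u\<in>cells N {1, N}. ennreal (\<bar>G u\<bar> powr (b * p)) \<partial>uniform01))"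
  proof -
    let ?S = "\<lambda>i u. ennreal ((t N i - t N (i - 1)) powr (b * p)) * indicator (cells N {i}) u"
    let ?T = "\<lambda>u. ennreal (\<bar>G u\<bar> powr (b * p)) * indicator (cells N {1, N}) u"
    have "(\<integral>\<^sup>+u. ennreal (C powr p) * ((\<Sum>i=2..N-1. ?S i u) + ?T u) \<partial>uniform01)
        = ennreal (C powr p) * (\<integral>\<^sup>+u. (\<Sum>i=2..N-1. ?S i u) + ?T u \<partial>uniform01)"
      by (rule nn_integral_cmult) measurable
    also have "(\<integral>\<^sup>+u. (\<Sum>i=2..N-1. ?S i u) + ?T u \<partial>uniform01)
        = (\<integral>\<^sup>+u. (\<Sum>i=2..N-1. ?S i u) \<partial>uniform01) + (\<integral>\<^sup>+u. ?T u \<partial>uniform01)"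
      by (rule nn_integral_add) measurable
    also have "(\<integral>\<^sup>+u. (\<Sum>i=2..N-1. ?S i u) \<partial>uniform01) = (\<Sum>i=2..N-1. \<integral>\<^sup>+u. ?S i u \<partial>uniform01)"
      by (rule nn_integral_sum) measurable
    finally show ?thesis .
  qed
  also have "(\<Sum>i=2..N-1. \<integral>\<^sup>+u\<in>cells N {i}. ennreal ((t N i - t N (i - 1)) powr (b * p)) \<partial>uniform01)
      = (\<Sum>i=2..N-1. ennreal ((t N i - t N (i - 1)) powr (b * p) / N))"
    by (intro sum.cong nn_integral_cell_const) auto
  also have "\<dots> = ennreal ((\<Sum>i=2..N-1. (t N i - t N (i - 1)) powr (b * p)) / N)"
    by (subst sum_ennreal) (auto simp: sum_divide_distrib)
  finally have cost: "(\<integral>\<^sup>+u. ennreal (norm ((h \<circ> G) u - x (cell N u)) powr p) \<partial>uniform01)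
      \<le> ennreal (C powr p) *
        (ennreal ((\<Sum>i=2..N-1. (t N i - t N (i - 1)) powr (b * p)) / N) +
         (\<integral>\<^sup>+u\<in>cells N {1, N}. ennreal (\<bar>G u\<bar> powr (b * p)) \<partial>uniform01))" .
  have "quant_error N p (distr uniform01 borel (h \<circ> G))
      \<le> ennpow (\<integral>\<^sup>+u. ennreal (norm ((h \<circ> G) u - x (cell N u)) powr p) \<partial>uniform01) (1 / p)"
    by (intro quant_error_le assms) (simp add: comp_def)
  then show ?thesis
    unfolding quantile_cost_eq by (rule order_trans) (rule ennpow_mono[OF cost], use assms in simp)
qed

end

section \<open>Cost of the increments and comparison with the rate\<close>

context quantile_function
begin

text \<open>For exponents at least 1 the worst case is a single jump between the outermost nodes,
  which lie within \<open>R\<close> of 0.\<close>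

lemma increments_cost_ge1:
  assumes "1 \<le> N" "1 \<le> r" "0 < \<sigma>" "0 < \<kappa>"
    and tail: "(\<integral>\<^sup>+u\<in>cells N {1, N}. ennreal (\<bar>G u\<bar> powr \<sigma>) \<partial>uniform01) \<le> ennreal \<kappa>"
  shows "(\<Sum>i=2..N-1. (t N i - t N (i - 1)) powr r) / N
    \<le> 2 powr r * (N powr (r / \<sigma> - 1) * \<kappa> powr (r / \<sigma>))"
proof (cases "2 \<le> N")
  case True
  define R where "R = (N * \<kappa>) powr (1 / \<sigma>)"
  have R: "\<bar>t N i\<bar> \<le> R" if "i \<in> {1..N-1}" for i
    unfolding R_def using that assms by (intro abs_t_le) auto
  have "(\<Sum>i=2..N-1. (t N i - t N (i - 1)) powr r) \<le> (t N (N - 1) - t N 1) powr r"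
    using True assms by (intro sum_powr_increments_le[OF mono_on_t]) auto
  also have "\<dots> \<le> (2 * R) powr r"
  proof (intro powr_mono2)
    have *: "1 \<in> {1..N-1}" "N - 1 \<in> {1..N-1}" "1 \<le> N - 1" using True by auto
    show "0 \<le> t N (N - 1) - t N 1" using mono_onD[OF mono_on_t *] by simp
    show "t N (N - 1) - t N 1 \<le> 2 * R" using R[OF *(1)] R[OF *(2)] by linarith
  qed (use assms in auto)
  finally have "(\<Sum>i=2..N-1. (t N i - t N (i - 1)) powr r) / N \<le> (2 * R) powr r / N"
    by (intro divide_right_mono) auto
  also have "(2 * R) powr r / N = 2 powr r * (N powr (r / \<sigma> - 1) * \<kappa> powr (r / \<sigma>))"
    using assms by (simp add: R_def powr_powr powr_mult powr_diff)
  finally show ?thesis .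
qed (use assms in auto)

lemma increments_cost_lt1:
  assumes "1 \<le> N" "0 < r" "r < 1" "0 < \<sigma>" "0 < \<kappa>" "0 \<le> M"
    and tail: "(\<integral>\<^sup>+u\<in>cells N {1, N}. ennreal (\<bar>G u\<bar> powr \<sigma>) \<partial>uniform01) \<le> ennreal \<kappa>"
    and total: "(\<integral>\<^sup>+u. ennreal (\<bar>G u\<bar> powr \<sigma>) \<partial>uniform01) \<le> ennreal M"
  shows "(\<Sum>i=2..N-1. (t N i - t N (i - 1)) powr r) / N
    \<le> (2 powr \<sigma> * (1 + 4 * M)) powr (1 - r) * (N powr (- r) *
        (2 * Phi (\<sigma> * (1 - r) / r) ((N * \<kappa>) powr (1 / \<sigma>))) powr r)"
proof -
  define A where "A = (2 * Phi (\<sigma> * (1 - r) / r) ((N * \<kappa>) powr (1 / \<sigma>))) powr r"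
  have "(\<Sum>i=2..N-1. (t N i - t N (i - 1)) powr r)
      \<le> A * (2 powr \<sigma> * (real (N - 1) + 2 * (2 * real N * M))) powr (1 - r)"
    unfolding A_def
  proof (rule sum_powr_increments_lt1[OF mono_on_t])
    show "\<bar>t N i\<bar> \<le> (N * \<kappa>) powr (1 / \<sigma>)" if "i \<in> {1..N-1}" for i
      using that assms by (intro abs_t_le) auto
    show "(\<Sum>i=1..N-1. \<bar>t N i\<bar> powr \<sigma>) \<le> 2 * real N * M"
      using assms by (intro sum_t_powr_le) auto
  qed (use assms in auto)
  also have "\<dots> \<le> A * (2 powr \<sigma> * (1 + 4 * M) * N) powr (1 - r)"
  proof (intro mult_left_mono powr_mono2)
    have "real (N - 1) + 2 * (2 * real N * M) \<le> (1 + 4 * M) * N"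
      using assms(1) by (simp add: algebra_simps)
    then show "2 powr \<sigma> * (real (N - 1) + 2 * (2 * real N * M)) \<le> 2 powr \<sigma> * (1 + 4 * M) * N"
      unfolding mult.assoc by (intro mult_left_mono) auto
  qed (use assms in \<open>auto simp: A_def\<close>)
  finally have "(\<Sum>i=2..N-1. (t N i - t N (i - 1)) powr r) / N
      \<le> A * (2 powr \<sigma> * (1 + 4 * M) * N) powr (1 - r) / N"
    by (intro divide_right_mono) auto
  also have "\<dots> = A * ((2 powr \<sigma> * (1 + 4 * M)) powr (1 - r) * (N powr (1 - r) / N))"
    using assms by (simp add: powr_mult)
  also have "real N powr (1 - r) / N = N powr (- r)"
    using assms by (simp add: powr_diff powr_minus_divide)
  finally show ?thesis by (simp add: A_def mult_ac)
qed

end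

text \<open>The $p$-th power of the rate, where $r = p/d$ and $s = p/q$.\<close>

definition rate1 :: "real \<Rightarrow> real \<Rightarrow> nat \<Rightarrow> real"
  where "rate1 r s N = (if r + s \<noteq> 1
    then max (N powr (s - 1)) (N powr (- r)) else N powr (- r) * ln (1 + N) powr r)"

text \<open>The cost of the end cells has order \<open>N powr (s - 1)\<close> and must never exceed
  the rate. In the critical case both powers of \<open>N\<close> coincide and the logarithm is at
  least \<open>ln 2\<close>, its value at \<open>N = 1\<close>.\<close>

lemma rate1_ge:
  assumes "1 \<le> N" "0 < r"
  shows "min 1 (ln 2 powr r) * N powr (s - 1) \<le> rate1 r s N"
proof (cases "r + s = 1")
  case True
  then have e: "s - 1 = - r" by simp
  have "min 1 (ln 2 powr r) \<le> ln (1 + real N) powr r"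
    using assms by (intro min.coboundedI2 powr_mono2) (auto simp: ln_ge_zero)
  then show ?thesis
    unfolding rate1_def e using True by (simp add: mult.commute mult_left_mono)
next
  case False
  have "min 1 (ln 2 powr r) * N powr (s - 1) \<le> 1 * N powr (s - 1)"
    by (intro mult_right_mono) auto
  then show ?thesis using False by (simp add: rate1_def max.coboundedI1)
qed

lemma rate1_pos: "1 \<le> N \<Longrightarrow> 0 < rate1 r s N"
  by (auto simp: rate1_def less_max_iff_disj)

text \<open>For \<open>a < 1\<close> the primitive is at most (1 + x)^(1 - a) / (1 - a). Extracting
  N^(1/\<sigma>) from 1 + x leaves \<open>y\<close>, and the powers of \<open>N\<close> combine to
  r/\<sigma> - 1 because a r = \<sigma> (1 - r). Keeping \<kappa> visible lets the same estimate
  serve the upper bound and the limit.\<close>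

lemma Phi_subcritical_bound:
  assumes "0 < r" "r < 1" "0 < \<sigma>"
  defines "a \<equiv> \<sigma> * (1 - r) / r"
  assumes "a < 1" "1 \<le> N" "0 \<le> \<kappa>"
  shows "N powr (- r) * (2 * Phi a ((N * \<kappa>) powr (1 / \<sigma>))) powr r
    \<le> N powr (r / \<sigma> - 1) * ((2 / (1 - a)) powr r * (N powr (- 1 / \<sigma>) + \<kappa> powr (1 / \<sigma>)) powr ((1 - a) * r))"
proof -
  have a0: "0 < a" using assms by (simp add: a_def)
  define x where "x = (N * \<kappa>) powr (1 / \<sigma>)"
  define y where "y = N powr (- 1 / \<sigma>) + \<kappa> powr (1 / \<sigma>)"
  have "N powr (1 / \<sigma>) * N powr (- 1 / \<sigma>) = 1" using assms by (simp flip: powr_add)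
  then have xy: "1 + x = N powr (1 / \<sigma>) * y"
    using assms by (simp add: x_def y_def powr_mult distrib_left)
  have Phi0: "0 \<le> Phi a x" using Phi_mono[of 0 x a] a0 by (simp add: x_def)
  have "Phi a x \<le> (1 + x) powr (1 - a) / (1 - a)"
    using assms by (simp add: Phi_def divide_right_mono)
  then have "(2 * Phi a x) powr r \<le> (2 * ((1 + x) powr (1 - a) / (1 - a))) powr r"
    using Phi0 assms by (intro powr_mono2) auto
  also have "\<dots> = (2 / (1 - a) * (1 + x) powr (1 - a)) powr r" by simp
  also have "\<dots> = (2 / (1 - a)) powr r * (1 + x) powr ((1 - a) * r)"
    by (simp only: powr_mult powr_powr)
  also have "(1 + x) powr ((1 - a) * r) = N powr (1 / \<sigma> * ((1 - a) * r)) * y powr ((1 - a) * r)"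
    unfolding xy using assms by (simp add: powr_mult powr_powr y_def)
  finally have "N powr (- r) * (2 * Phi a x) powr r \<le> N powr (- r) *
      ((2 / (1 - a)) powr r * (N powr (1 / \<sigma> * ((1 - a) * r)) * y powr ((1 - a) * r)))"
    by (intro mult_left_mono) auto
  also have "\<dots> = N powr (- r + 1 / \<sigma> * ((1 - a) * r)) * ((2 / (1 - a)) powr r * y powr ((1 - a) * r))"
    by (simp only: powr_add) (simp only: mult_ac)
  also have "- r + 1 / \<sigma> * ((1 - a) * r) = r / \<sigma> - 1"
    using assms by (simp add: a_def field_simps)
  finally show ?thesis unfolding x_def y_def .
qed

text \<open>Comparing a with 1 is the same as comparing 1 with r + r/\<sigma>: for a > 1 the
  primitive is bounded and N^(-r) remains, a = 1 produces the logarithm, and a < 1 gives the power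
  N^(r/\<sigma> - 1).\<close>

lemma Phi_rate_bound:
  assumes "0 < r" "r < 1" "0 < \<sigma>"
  shows "\<exists>K>0. \<forall>N::nat\<ge>1. N powr (- r) * (2 * Phi (\<sigma> * (1 - r) / r) (N powr (1 / \<sigma>))) powr r \<le> K * rate1 r (r / \<sigma>) N"
proof -
  define a where "a = \<sigma> * (1 - r) / r"
  have a0: "0 < a" using assms by (simp add: a_def)
  have Phi0: "0 \<le> Phi a x" if "0 \<le> x" for x
    using Phi_mono[of 0 x a] that a0 by simp
  consider "a > 1" | "a = 1" | "a < 1" by linarith
  then show ?thesis
  proof cases
    case 1
    have "N powr (- r) * (2 * Phi a (N powr (1 / \<sigma>))) powr r \<le> (2 / (a - 1)) powr r * rate1 r (r / \<sigma>) N"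
      if "1 \<le> N" for N :: nat
    proof -
      have "Phi a x \<le> 1 / (a - 1)" if "0 \<le> x" for x
      proof -
        have "Phi a x = (1 - (1 + x) powr (1 - a)) / (a - 1)"
          using 1 by (simp add: Phi_def divide_simps) (simp add: algebra_simps)
        also have "\<dots> \<le> 1 / (a - 1)" using 1 by (intro divide_right_mono) auto
        finally show ?thesis .
      qed
      then have "(2 * Phi a (N powr (1 / \<sigma>))) powr r \<le> (2 * (1 / (a - 1))) powr r"
        using Phi0 assms by (intro powr_mono2 mult_left_mono) auto
      then have "N powr (- r) * (2 * Phi a (N powr (1 / \<sigma>))) powr r \<le> N powr (- r) * (2 / (a - 1)) powr r"
        by (intro mult_left_mono) auto
      moreover have "N powr (- r) \<le> rate1 r (r / \<sigma>) N"
      proof -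
        have "r + r / \<sigma> \<noteq> 1" using 1 assms by (auto simp: a_def field_simps)
        then show ?thesis by (simp add: rate1_def)
      qed
      then have "N powr (- r) * (2 / (a - 1)) powr r \<le> rate1 r (r / \<sigma>) N * (2 / (a - 1)) powr r"
        by (intro mult_right_mono) auto
      ultimately show ?thesis by (simp add: mult.commute)
    qed
    then show ?thesis using 1 by (intro exI[of _ "(2 / (a - 1)) powr r"]) (simp flip: a_def)
  next
    case 2
    \<comment> \<open>With m at least 1, the number 1 + N^(1/\<sigma>) is at most (1 + N)^(2 m) for
      every N \<ge> 1, so its logarithm is compared with ln (1 + N) without excluding small
      N.\<close>
    define m where "m = max 1 (1 / \<sigma>)"
    have m: "1 \<le> m" "1 / \<sigma> \<le> m" by (simp_all add: m_def)
    have "N powr (- r) * (2 * Phi a (N powr (1 / \<sigma>))) powr r \<le> (4 * m) powr r * rate1 r (r / \<sigma>) N"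
      if N: "1 \<le> N" for N :: nat
    proof -
      have "1 + N powr (1 / \<sigma>) \<le> (1 + real N) powr m + (1 + real N) powr m"
      proof (intro add_mono)
        show "1 \<le> (1 + real N) powr m" using m by (intro ge_one_powr_ge_zero) auto
        have "N powr (1 / \<sigma>) \<le> N powr m" using m N by (intro powr_mono) auto
        also have "\<dots> \<le> (1 + real N) powr m" using m by (intro powr_mono2) auto
        finally show "N powr (1 / \<sigma>) \<le> (1 + real N) powr m" .
      qed
      also have "\<dots> \<le> (1 + real N) powr m * (1 + real N) powr m"
      proof -
        have "(1 + real N) powr 1 \<le> (1 + real N) powr m" using m by (intro powr_mono) auto
        then have "2 \<le> (1 + real N) powr m" using N by simp
        then have "2 * (1 + real N) powr m \<le> (1 + real N) powr m * (1 + real N) powr m"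
          by (intro mult_right_mono) auto
        then show ?thesis by simp
      qed
      also have "\<dots> = (1 + real N) powr (2 * m)" by (simp flip: powr_add)
      finally have "ln (1 + N powr (1 / \<sigma>)) \<le> ln ((1 + real N) powr (2 * m))"
        by (subst ln_le_cancel_iff) (auto simp: add_pos_nonneg)
      then have "Phi a (N powr (1 / \<sigma>)) \<le> 2 * m * ln (1 + real N)"
        using 2 by (simp add: Phi_def ln_powr)
      then have "(2 * Phi a (N powr (1 / \<sigma>))) powr r \<le> (4 * m * ln (1 + real N)) powr r"
        using Phi0[of "N powr (1 / \<sigma>)"] assms by (intro powr_mono2) auto
      also have "\<dots> = (4 * m) powr r * ln (1 + real N) powr r"
        using m by (intro powr_mult)
      finally have "N powr (- r) * (2 * Phi a (N powr (1 / \<sigma>))) powr r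
          \<le> N powr (- r) * ((4 * m) powr r * ln (1 + real N) powr r)"
        by (intro mult_left_mono) auto
      moreover have "r + r / \<sigma> = 1" using 2 assms by (auto simp: a_def field_simps)
      ultimately show ?thesis by (simp add: rate1_def mult_ac)
    qed
    then show ?thesis using m by (intro exI[of _ "(4 * m) powr r"]) (simp flip: a_def)
  next
    case 3
    define K where "K = (2 / (1 - a)) powr r * 2 powr ((1 - a) * r)"
    have K: "0 < K" using 3 by (simp add: K_def)
    have "N powr (- r) * (2 * Phi a (N powr (1 / \<sigma>))) powr r \<le> K * rate1 r (r / \<sigma>) N"
      if N: "1 \<le> N" for N :: nat
    proof -
      have "N powr (- r) * (2 * Phi a (N powr (1 / \<sigma>))) powr r
          \<le> N powr (r / \<sigma> - 1) * ((2 / (1 - a)) powr r * (N powr (- 1 / \<sigma>) + 1) powr ((1 - a) * r))"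
        using Phi_subcritical_bound[OF assms, of N 1] N 3 by (simp add: a_def)
      also have "\<dots> \<le> N powr (r / \<sigma> - 1) * K"
        unfolding K_def
      proof (intro mult_left_mono powr_mono2)
        have "N powr (- 1 / \<sigma>) \<le> N powr 0" using N assms by (intro powr_mono) auto
        then show "N powr (- 1 / \<sigma>) + 1 \<le> 2" using N by simp
      qed (use 3 assms in auto)
      also have "\<dots> \<le> rate1 r (r / \<sigma>) N * K"
      proof (intro mult_right_mono)
        have "r + r / \<sigma> \<noteq> 1" using 3 assms by (auto simp: a_def field_simps)
        then show "N powr (r / \<sigma> - 1) \<le> rate1 r (r / \<sigma>) N" by (simp add: rate1_def)
      qed (use K in auto)
      finally show ?thesis by (simp add: mult.commute)
    qed
    then show ?thesis using K by (intro exI[of _ K]) (simp flip: a_def)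
  qed
qed

text \<open>For a normalized moment both \<kappa> and the total moment may be taken as 1, so the
  constant depends only on the exponents.\<close>

lemma quantile_cost_bound:
  assumes "0 < r" "r < \<sigma>"
  shows "\<exists>K>0. \<forall>G N. quantile_function G \<longrightarrow> (\<integral>\<^sup>+u. ennreal (\<bar>G u\<bar> powr \<sigma>) \<partial>uniform01) \<le> 1 \<longrightarrow> 1 \<le> N \<longrightarrow>
    quantile_cost G N r \<le> ennreal (K * rate1 r (r / \<sigma>) N)"
proof -
  have s: "0 < \<sigma>" using assms by simp
  define c where "c = min 1 (ln 2 powr r)"
  have c: "0 < c" using assms by (simp add: c_def)
  have c_le: "N powr (r / \<sigma> - 1) \<le> 1 / c * rate1 r (r / \<sigma>) N" if "1 \<le> N" for N :: nat
    using rate1_ge[OF that assms(1), of "r / \<sigma>"] c by (simp add: c_def[symmetric] field_simps)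
  define inc where "inc N = (if 1 \<le> r then 2 powr r * N powr (r / \<sigma> - 1) else
      (2 powr \<sigma> * (1 + 4 * 1)) powr (1 - r) *
        (N powr (- r) * (2 * Phi (\<sigma> * (1 - r) / r) (N powr (1 / \<sigma>))) powr r))" for N :: nat
  have "\<exists>K>0. \<forall>N\<ge>1. inc N \<le> K * rate1 r (r / \<sigma>) N"
  proof (cases "1 \<le> r")
    case True
    have "inc N \<le> 2 powr r * (1 / c) * rate1 r (r / \<sigma>) N" if "1 \<le> N" for N
      using mult_left_mono[OF c_le[OF that], of "2 powr r"] True by (simp add: inc_def)
    then show ?thesis using c by (intro exI[of _ "2 powr r * (1 / c)"]) auto
  next
    case False
    then have "r < 1" by simp
    from Phi_rate_bound[OF assms(1) this s] obtain K where K: "0 < K"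
      "\<forall>N::nat\<ge>1. N powr (- r) * (2 * Phi (\<sigma> * (1 - r) / r) (N powr (1 / \<sigma>))) powr r \<le> K * rate1 r (r / \<sigma>) N"
      by blast
    define D where "D = (2 powr \<sigma> * (1 + 4 * 1)) powr (1 - r)"
    have D: "0 < D" by (simp add: D_def)
    have "inc N \<le> D * K * rate1 r (r / \<sigma>) N" if "1 \<le> N" for N
      unfolding inc_def mult.assoc D_def[symmetric] using K(2) that D False
      by (simp add: mult_left_mono)
    then show ?thesis using D K(1) by (intro exI[of _ "D * K"]) auto
  qed
  then obtain K where K: "0 < K" "\<And>N. 1 \<le> N \<Longrightarrow> inc N \<le> K * rate1 r (r / \<sigma>) N" by blast
  show ?thesis
  proof (intro exI[of _ "K + 3 * (1 / c)"] conjI allI impI)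
    show "0 < K + 3 * (1 / c)" using K(1) c by (intro add_pos_pos) auto
    fix G and N :: nat
    assume "quantile_function G" and G: "(\<integral>\<^sup>+u. ennreal (\<bar>G u\<bar> powr \<sigma>) \<partial>uniform01) \<le> 1" and N: "1 \<le> N"
    interpret quantile_function G by fact
    have t1: "(\<integral>\<^sup>+u\<in>cells N {1, N}. ennreal (\<bar>G u\<bar> powr \<sigma>) \<partial>uniform01) \<le> ennreal 1"
      unfolding ennreal_1 by (rule order_trans[OF nn_integral_mono G]) (auto simp: indicator_def)
    have "(\<integral>\<^sup>+u\<in>cells N {1, N}. ennreal (\<bar>G u\<bar> powr r) \<partial>uniform01) \<le> ennreal (3 * N powr (r / \<sigma> - 1))"
      using tail_powr_le[OF N assms _ t1] by simp
    also have "\<dots> \<le> ennreal (3 * (1 / c * rate1 r (r / \<sigma>) N))"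
      using c_le[OF N] by (intro ennreal_leI) auto
    finally have tail: "(\<integral>\<^sup>+u\<in>cells N {1, N}. ennreal (\<bar>G u\<bar> powr r) \<partial>uniform01)
        \<le> ennreal (3 * (1 / c * rate1 r (r / \<sigma>) N))" .
    have "(\<Sum>i=2..N-1. (t N i - t N (i - 1)) powr r) / N \<le> inc N"
      using increments_cost_ge1[OF N _ s _ t1, of r] increments_cost_lt1[OF N assms(1) _ s _ _ t1, of 1] G
      by (simp add: inc_def)
    then have incr: "(\<Sum>i=2..N-1. (t N i - t N (i - 1)) powr r) / N \<le> K * rate1 r (r / \<sigma>) N"
      using K(2)[OF N] by (rule order_trans)
    have r0: "0 \<le> rate1 r (r / \<sigma>) N" using rate1_pos[OF N] by (rule less_imp_le)
    have "quantile_cost G N r \<le> ennreal (K * rate1 r (r / \<sigma>) N) + ennreal (3 * (1 / c * rate1 r (r / \<sigma>) N))"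
      unfolding quantile_cost_eq using incr tail by (intro add_mono ennreal_leI)
    also have "\<dots> = ennreal (K * rate1 r (r / \<sigma>) N + 3 * (1 / c * rate1 r (r / \<sigma>) N))"
      using r0 K(1) c by (intro ennreal_plus[symmetric]) auto
    also have "K * rate1 r (r / \<sigma>) N + 3 * (1 / c * rate1 r (r / \<sigma>) N) = (K + 3 * (1 / c)) * rate1 r (r / \<sigma>) N"
      by (simp add: distrib_right)
    finally show "quantile_cost G N r \<le> ennreal ((K + 3 * (1 / c)) * rate1 r (r / \<sigma>) N)" .
  qed
qed

text \<open>A bounded \<open>G\<close> has all moments, so \<sigma> can be chosen freely. For r < 1
  a large enough \<sigma> already yields N^(-r). For r \<ge> 1 the rate 1/N is reached because
  boundedness also makes the end cell moment of order 1/N.\<close>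

lemma bounded_quantile_cost_bound:
  assumes "0 < r"
  shows "\<exists>K>0. \<forall>G N. quantile_function G \<longrightarrow> (AE u in uniform01. \<bar>G u\<bar> \<le> 1) \<longrightarrow> 1 \<le> N \<longrightarrow>
    quantile_cost G N r \<le> ennreal (K * rate1 r 0 N)"
proof (cases "1 \<le> r")
  case False
  \<comment> \<open>This makes the weight exponent a equal to 2, safely in the range where the
    primitive is bounded.\<close>
  define \<sigma> where "\<sigma> = 2 * r / (1 - r)"
  have s: "0 < \<sigma>" "r < \<sigma>" "r / \<sigma> = (1 - r) / 2"
    using assms False by (auto simp: \<sigma>_def field_simps intro!: add_pos_pos)
  obtain K where K: "0 < K"
    "\<And>G N. quantile_function G \<Longrightarrow> (\<integral>\<^sup>+u. ennreal (\<bar>G u\<bar> powr \<sigma>) \<partial>uniform01) \<le> 1 \<Longrightarrow> 1 \<le> N \<Longrightarrow>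
      quantile_cost G N r \<le> ennreal (K * rate1 r (r / \<sigma>) N)"
    using quantile_cost_bound[OF assms s(2)] by blast
  show ?thesis
  proof (intro exI[of _ K] conjI allI impI K(1))
    fix G and N :: nat
    assume G: "quantile_function G" "AE u in uniform01. \<bar>G u\<bar> \<le> 1" and N: "1 \<le> N"
    interpret prob_space uniform01 by (rule prob_space_uniform01)
    have "(\<integral>\<^sup>+u. ennreal (\<bar>G u\<bar> powr \<sigma>) \<partial>uniform01) \<le> (\<integral>\<^sup>+u. 1 \<partial>uniform01)"
    proof (rule nn_integral_mono_AE)
      show "AE u in uniform01. ennreal (\<bar>G u\<bar> powr \<sigma>) \<le> 1"
        using G(2)
      proof eventually_elim
        case (elim u)
        then have "\<bar>G u\<bar> powr \<sigma> \<le> 1 powr \<sigma>" using s by (intro powr_mono2) auto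
        then show ?case by (simp add: ennreal_le_1)
      qed
    qed
    then have "(\<integral>\<^sup>+u. ennreal (\<bar>G u\<bar> powr \<sigma>) \<partial>uniform01) \<le> 1"
      unfolding nn_integral_const emeasure_space_1 by simp
    moreover have "rate1 r (r / \<sigma>) N = rate1 r 0 N"
    proof -
      have "real N powr ((1 - r) / 2 - 1) \<le> N powr (- r)" "real N powr (- 1) \<le> N powr (- r)"
        using N False assms by (intro powr_mono; simp add: field_simps)+
      moreover have "r + (1 - r) / 2 \<noteq> 1" "r \<noteq> 1" using False by (auto simp: field_simps)
      ultimately show ?thesis unfolding s(3) by (simp add: rate1_def max_absorb2)
    qed
    ultimately show "quantile_cost G N r \<le> ennreal (K * rate1 r 0 N)"
      using K(2)[OF G(1) _ N] by simp
  qed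
next
  case True
  define c where "c = min 1 (ln 2 powr r)"
  have c: "0 < c" using assms by (simp add: c_def)
  define D where "D = (2 powr r + 3) * 2 powr (1 / 2)"
  have D: "0 < D" by (simp add: D_def add_pos_pos)
  show ?thesis
  proof (intro exI[of _ "D / c"] conjI allI impI)
    show "0 < D / c" using c D by simp
    fix G and N :: nat
    assume "quantile_function G" and G: "AE u in uniform01. \<bar>G u\<bar> \<le> 1" and N: "1 \<le> N"
    interpret quantile_function G by fact
    \<comment> \<open>Two cells of mass 1/N on which the integrand is at most 1. With exponent
      \<open>2 * r\<close> both cost terms become multiples of N^(-1/2) \<kappa>^(1/2), that is, of
      1/N.\<close>
    define \<kappa> where "\<kappa> = 2 / real N"
    have \<kappa>: "0 < \<kappa>" using N by (simp add: \<kappa>_def)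
    have "(\<integral>\<^sup>+u\<in>cells N {1, N}. ennreal (\<bar>G u\<bar> powr (2 * r)) \<partial>uniform01)
        \<le> (\<integral>\<^sup>+u\<in>cells N {1, N}. ennreal 1 \<partial>uniform01)"
    proof (rule nn_integral_mono_AE)
      show "AE u in uniform01. ennreal (\<bar>G u\<bar> powr (2 * r)) * indicator (cells N {1, N}) u
          \<le> ennreal 1 * indicator (cells N {1, N}) u"
        using G
      proof eventually_elim
        case (elim u)
        then have "\<bar>G u\<bar> powr (2 * r) \<le> 1 powr (2 * r)" using assms by (intro powr_mono2) auto
        then show ?case by (intro mult_right_mono ennreal_leI) auto
      qed
    qed
    also have "\<dots> \<le> ennreal (2 * (1 / N))" by (rule nn_integral_end_cells_const_le[OF N]) simp
    finally have tail: "(\<integral>\<^sup>+u\<in>cells N {1, N}. ennreal (\<bar>G u\<bar> powr (2 * r)) \<partial>uniform01) \<le> ennreal \<kappa>"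
      by (simp add: \<kappa>_def)
    have r2: "0 < 2 * r" "r < 2 * r" "r / (2 * r) = 1 / 2" using assms by auto
    define E where "E = real N powr (r / (2 * r) - 1) * \<kappa> powr (r / (2 * r))"
    have E: "E = 2 powr (1 / 2) * N powr (0 - 1)"
      using N unfolding E_def r2(3) \<kappa>_def by (simp add: powr_divide powr_minus_divide flip: powr_add)
    have "(\<Sum>i=2..N-1. (t N i - t N (i - 1)) powr r) / N \<le> 2 powr r * E"
      unfolding E_def by (rule increments_cost_ge1[OF N True r2(1) \<kappa> tail])
    moreover have "(\<integral>\<^sup>+u\<in>cells N {1, N}. ennreal (\<bar>G u\<bar> powr r) \<partial>uniform01) \<le> ennreal (3 * E)"
      unfolding E_def by (rule tail_powr_le[OF N assms r2(2) \<kappa> tail])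
    ultimately have "quantile_cost G N r \<le> ennreal (2 powr r * E) + ennreal (3 * E)"
      unfolding quantile_cost_eq by (intro add_mono ennreal_leI)
    also have "\<dots> = ennreal (D * N powr (0 - 1))"
      by (subst ennreal_plus[symmetric]) (auto simp: E D_def algebra_simps)
    also have "\<dots> \<le> ennreal (D / c * rate1 r 0 N)"
    proof (rule ennreal_leI)
      have "N powr (0 - 1) \<le> rate1 r 0 N / c"
        using rate1_ge[OF N assms, of 0] c by (simp add: c_def[symmetric] field_simps)
      then have "D * N powr (0 - 1) \<le> D * (rate1 r 0 N / c)" using D by (intro mult_left_mono) auto
      then show "D * N powr (0 - 1) \<le> D / c * rate1 r 0 N" by simp
    qed
    finally show "quantile_cost G N r \<le> ennreal (D / c * rate1 r 0 N)" .
  qed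
qed

section \<open>Rescaling and the passage from the line to space\<close>

lemma (in quantile_function) quantile_function_divide:
  assumes "0 < \<rho>"
  shows "quantile_function (\<lambda>u. G u / \<rho>)"
proof
  show "mono_on {0<..<1} (\<lambda>u. G u / \<rho>)"
    using mono_G assms by (auto simp: mono_on_def divide_right_mono)
qed measurable

text \<open>Dividing \<open>G\<close> by \<rho> and stretching the curve by \<rho> leaves the
  composition unchanged and multiplies the Hoelder constant by \<open>\<rho> powr b\<close>. So
  costs need to be estimated for normalized \<open>G\<close> only.\<close>

lemma (in quantile_function) quant_error_rescaled_le:
  fixes h :: "real \<Rightarrow> 'a::euclidean_space"
  assumes h: "\<And>x y. norm (h x - h y) \<le> C * \<bar>x - y\<bar> powr b" and "continuous_on UNIV h"
    and "0 < C" "0 < b" "0 < p" "1 \<le> N" "0 < \<rho>" "0 \<le> B"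
    and cost: "quantile_cost (\<lambda>u. G u / \<rho>) N (b * p) \<le> ennreal B"
  shows "quant_error N p (distr uniform01 borel (h \<circ> G)) \<le> ennreal (C * \<rho> powr b * B powr (1 / p))"
proof -
  interpret scaled: quantile_function "\<lambda>u. G u / \<rho>"
    by (rule quantile_function_divide) fact
  define h' where "h' x = h (\<rho> * x)" for x
  have h': "norm (h' x - h' y) \<le> (C * \<rho> powr b) * \<bar>x - y\<bar> powr b" for x y
  proof -
    have "\<bar>\<rho> * x - \<rho> * y\<bar> powr b = \<rho> powr b * \<bar>x - y\<bar> powr b"
      using assms by (simp add: abs_mult powr_mult flip: right_diff_distrib)
    then show ?thesis using h[of "\<rho> * x" "\<rho> * y"] by (simp add: h'_def mult.assoc)
  qed
  have cont: "continuous_on UNIV h'"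
    unfolding h'_def by (intro continuous_on_compose2[OF assms(2)] continuous_intros) auto
  have "h' \<circ> (\<lambda>u. G u / \<rho>) = h \<circ> G" using assms by (auto simp: h'_def fun_eq_iff)
  then have "quant_error N p (distr uniform01 borel (h \<circ> G))
      \<le> ennpow (ennreal ((C * \<rho> powr b) powr p) * quantile_cost (\<lambda>u. G u / \<rho>) N (b * p)) (1 / p)"
    using scaled.quant_error_Hoelder_le[OF h' cont, of p N] assms by simp
  also have "\<dots> \<le> ennpow (ennreal ((C * \<rho> powr b) powr p) * ennreal B) (1 / p)"
    using assms by (intro ennpow_mono mult_left_mono cost) auto
  also have "\<dots> = ennreal (((C * \<rho> powr b) powr p * B) powr (1 / p))"
    using assms by (simp add: ennpow_ennreal flip: ennreal_mult)
  also have "((C * \<rho> powr b) powr p * B) powr (1 / p) = C * \<rho> powr b * B powr (1 / p)"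
    using assms by (simp only: powr_mult powr_powr) (simp add: powr_powr)
  finally show ?thesis .
qed

text \<open>\<open>G\<close> is the quantile function of the image of \<mu> under a Borel right
  inverse \<open>s\<close> of the curve; applying the curve gives back \<mu>, and the growth of
  \<open>s\<close> like |x|^d transfers moments and bounds. The curve and \<open>C\<close> are fixed
  before \<mu>, which makes the later constants uniform.\<close>

lemma curve_representation:
  obtains h :: "real \<Rightarrow> real ^ 'n::finite" and C :: real where "0 < C" "continuous_on UNIV h"
    "\<And>x y. norm (h x - h y) \<le> C * \<bar>x - y\<bar> powr (1 / CARD('n))"
    "\<And>\<mu>. \<mu> \<in> borel_probs \<Longrightarrow> \<exists>G. quantile_function G \<and> distr uniform01 borel (h \<circ> G) = \<mu> \<and>
      (\<forall>\<sigma>>0. (\<integral>\<^sup>+u. ennreal (\<bar>G u\<bar> powr \<sigma>) \<partial>uniform01) \<le> ennreal (C powr \<sigma>) * moment (real CARD('n) * \<sigma>) \<mu>) \<and>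
      (\<forall>R. (AE x in \<mu>. norm x \<le> R) \<longrightarrow> (AE u in uniform01. \<bar>G u\<bar> \<le> C * R ^ CARD('n)))"
proof -
  define d where "d = CARD('n)"
  have d: "0 < d" by (simp add: d_def)
  obtain h :: "real \<Rightarrow> real ^ 'n" and C where C: "C > 0"
    and h: "\<And>s t. norm (h s - h t) \<le> C * \<bar>s - t\<bar> powr (1 / d)"
    and onto: "\<And>x. \<exists>t. h t = x \<and> \<bar>t\<bar> \<le> C * norm x ^ d"
    by (rule space_filling_curve[where 'n='n, folded d_def], rule that)
  have cont: "continuous_on UNIV h" by (rule Hoelder_imp_continuous[OF h]) (use d in simp)
  obtain s where [measurable]: "s \<in> borel_measurable borel" and s: "\<And>x. h (s x) = x" "\<And>x. \<bar>s x\<bar> \<le> C * norm x ^ d"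
    by (rule measurable_right_inverse[OF cont onto], rule that)
  have [measurable]: "h \<in> borel_measurable borel" using cont by (rule borel_measurable_continuous_onI)
  show thesis
  proof (rule that[OF C cont h[unfolded d_def]])
    fix \<mu> :: "(real ^ 'n) measure" assume \<mu>: "\<mu> \<in> borel_probs"
    then have sets_\<mu> [measurable_cong]: "sets \<mu> = sets borel" and "prob_space \<mu>" by (auto simp: borel_probs_def)
    interpret prob_space \<mu> by fact
    have "prob_space (distr \<mu> borel s)" by (intro prob_space_distr) simp
    then obtain G where G: "mono_on {0<..<1} G" and [measurable]: "G \<in> borel_measurable uniform01"
      and distr_G: "distr uniform01 borel G = distr \<mu> borel s"
      using quantile_representation[of "distr \<mu> borel s"] by auto
    have "distr uniform01 borel (h \<circ> G) = distr (distr uniform01 borel G) borel h"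
      by (rule distr_distr[symmetric]) auto
    also have "\<dots> = distr \<mu> borel (h \<circ> s)" unfolding distr_G by (rule distr_distr) auto
    also have "\<dots> = \<mu>" using s(1) sets_\<mu> by (simp add: comp_def distr_id2)
    finally have "distr uniform01 borel (h \<circ> G) = \<mu>" .
    moreover have "(\<integral>\<^sup>+u. ennreal (\<bar>G u\<bar> powr \<sigma>) \<partial>uniform01) \<le> ennreal (C powr \<sigma>) * moment (real d * \<sigma>) \<mu>"
      if "0 < \<sigma>" for \<sigma>
    proof -
      have "(\<integral>\<^sup>+u. ennreal (\<bar>G u\<bar> powr \<sigma>) \<partial>uniform01)
          = (\<integral>\<^sup>+x. ennreal (\<bar>x\<bar> powr \<sigma>) \<partial>distr uniform01 borel G)"
        by (simp add: nn_integral_distr)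
      also have "\<dots> = (\<integral>\<^sup>+x. ennreal (\<bar>s x\<bar> powr \<sigma>) \<partial>\<mu>)"
        unfolding distr_G by (simp add: nn_integral_distr)
      also have "\<dots> \<le> (\<integral>\<^sup>+x. ennreal (C powr \<sigma>) * ennreal (norm x powr (real d * \<sigma>)) \<partial>\<mu>)"
      proof (rule nn_integral_mono)
        fix x
        have "\<bar>s x\<bar> powr \<sigma> \<le> (C * norm x ^ d) powr \<sigma>"
          using s(2)[of x] that by (intro powr_mono2) auto
        also have "\<dots> = C powr \<sigma> * norm x powr (real d * \<sigma>)"
        proof (cases "x = 0")
          case False
          then have "norm x ^ d = norm x powr d" by (simp add: powr_realpow)
          then show ?thesis by (simp add: powr_mult powr_powr)
        qed (use d that in \<open>simp add: power_0_left\<close>)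
        finally show "ennreal (\<bar>s x\<bar> powr \<sigma>) \<le> ennreal (C powr \<sigma>) * ennreal (norm x powr (real d * \<sigma>))"
          by (simp add: ennreal_leI flip: ennreal_mult')
      qed
      also have "\<dots> = ennreal (C powr \<sigma>) * moment (real d * \<sigma>) \<mu>"
        unfolding moment_def by (rule nn_integral_cmult) simp
      finally show ?thesis .
    qed
    moreover have "AE u in uniform01. \<bar>G u\<bar> \<le> C * R ^ d" if "AE x in \<mu>. norm x \<le> R" for R
    proof -
      have "AE x in \<mu>. \<bar>s x\<bar> \<le> C * R ^ d"
        using that
      proof eventually_elim
        case (elim x)
        have "\<bar>s x\<bar> \<le> C * norm x ^ d" by (rule s)
        also have "\<dots> \<le> C * R ^ d" using elim C by (intro mult_left_mono power_mono) auto
        finally show ?case .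
      qed
      then have "AE y in distr \<mu> borel s. \<bar>y\<bar> \<le> C * R ^ d" by (subst AE_distr_iff) auto
      then have "AE y in distr uniform01 borel G. \<bar>y\<bar> \<le> C * R ^ d" unfolding distr_G .
      then show ?thesis by (subst (asm) AE_distr_iff) auto
    qed
    ultimately show "\<exists>G. quantile_function G \<and> distr uniform01 borel (h \<circ> G) = \<mu> \<and>
      (\<forall>\<sigma>>0. (\<integral>\<^sup>+u. ennreal (\<bar>G u\<bar> powr \<sigma>) \<partial>uniform01) \<le> ennreal (C powr \<sigma>) * moment (real CARD('n) * \<sigma>) \<mu>) \<and>
      (\<forall>R. (AE x in \<mu>. norm x \<le> R) \<longrightarrow> (AE u in uniform01. \<bar>G u\<bar> \<le> C * R ^ CARD('n)))"
      using G unfolding d_def[symmetric] by (intro exI[of _ G]) (auto simp: quantile_function_def)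
  qed
qed

section \<open>The upper bound\<close>

lemma rate_eq_rate1:
  assumes "0 < p" "ereal p < q" "0 < d" "1 \<le> N"
  shows "rate d p q N = rate1 (p / d) (p * inv_exp q) N powr (1 / p)"
proof -
  have crit: "real d \<noteq> crit_dim p q \<longleftrightarrow> p / d + p * inv_exp q \<noteq> 1"
  proof (cases q)
    case (real q')
    then show ?thesis using assms by (auto simp: crit_dim_def inv_exp_def field_simps)
  qed (use assms in \<open>auto simp: crit_dim_def inv_exp_def field_simps\<close>)
  have max_powr: "max x y powr a = max (x powr a) (y powr a)" if "0 \<le> x" "0 \<le> y" "0 \<le> a" for x y a :: real
    using that powr_mono2[of a x y] powr_mono2[of a y x] by (auto simp: max_def)
  have "(p * inv_exp q - 1) / p = - 1 / p + inv_exp q" using assms by (simp add: diff_divide_distrib)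
  moreover have "p / d / p = 1 / d" using assms by simp
  ultimately show ?thesis
    unfolding rate_def rate1_def crit using assms
    by (auto simp: max_powr powr_powr powr_mult ln_ge_zero)
qed

text \<open>The scale of \<mu> may be 0, as for the Dirac measure at the origin, and then it cannot
  serve as a normalization. Therefore the bound is proved for every \<open>R\<close> above the
  scale, and \<open>R\<close> tends to it afterwards.\<close>

lemma le_mult_ennreal_if_le_mult_greater:
  assumes "S < \<infinity>" "0 < C" "0 < r" "\<And>R. 0 < R \<Longrightarrow> S < ennreal R \<Longrightarrow> e \<le> ennreal (C * R * r)"
  shows "e \<le> ennreal C * S * ennreal r"
proof -
  obtain s where s: "S = ennreal s" "0 \<le> s" using assms(1) by (cases S) auto
  have "e \<le> ennreal (C * s * r)"
  proof (rule ennreal_le_epsilon)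
    fix \<epsilon> :: real assume \<epsilon>: "0 < \<epsilon>"
    define R where "R = s + \<epsilon> / (C * r)"
    have "0 < \<epsilon> / (C * r)" using \<epsilon> assms by simp
    then have "0 < R" "S < ennreal R" using s by (auto simp: R_def ennreal_less_iff)
    then have "e \<le> ennreal (C * R * r)" by (rule assms(4))
    also have "C * R * r = C * s * r + \<epsilon>" using assms by (simp add: R_def field_simps)
    also have "ennreal \<dots> = ennreal (C * s * r) + ennreal \<epsilon>"
      using s \<epsilon> assms by (intro ennreal_plus) auto
    finally show "e \<le> ennreal (C * s * r) + ennreal \<epsilon>" .
  qed
  also have "\<dots> = ennreal C * S * ennreal r" using s assms by (simp add: ennreal_mult)
  finally show ?thesis .
qed

text \<open>By second countability the complement of the support is covered by countably many basic
  open null sets.\<close>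

lemma AE_in_msupport:
  fixes \<mu> :: "'a::second_countable_topology measure"
  assumes "sets \<mu> = sets borel"
  shows "AE x in \<mu>. x \<in> msupport \<mu>"
proof -
  obtain B :: "'a set set" where B: "countable B" "topological_basis B"
    using ex_countable_basis by blast
  have "(\<Union>b\<in>{b \<in> B. emeasure \<mu> b = 0}. b) \<in> null_sets \<mu>"
  proof (rule null_sets_UN')
    show "countable {b \<in> B. emeasure \<mu> b = 0}" using B(1) by simp
    fix b assume b: "b \<in> {b \<in> B. emeasure \<mu> b = 0}"
    then have "open b" using topological_basis_open[OF B(2)] by blast
    then show "b \<in> null_sets \<mu>" using b assms by (simp add: null_sets_def)
  qed
  moreover have "{x \<in> space \<mu>. x \<notin> msupport \<mu>} \<subseteq> (\<Union>b\<in>{b \<in> B. emeasure \<mu> b = 0}. b)"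
  proof
    fix x assume "x \<in> {x \<in> space \<mu>. x \<notin> msupport \<mu>}"
    then obtain U where U: "open U" "x \<in> U" "emeasure \<mu> U = 0"
      by (auto simp: msupport_def)
    obtain b where b: "b \<in> B" "x \<in> b" "b \<subseteq> U" using topological_basisE[OF B(2) U(1,2)] by blast
    then have "emeasure \<mu> b \<le> emeasure \<mu> U" using assms U(1) by (intro emeasure_mono) auto
    then show "x \<in> (\<Union>b\<in>{b \<in> B. emeasure \<mu> b = 0}. b)" using b U(3) by auto
  qed
  ultimately show ?thesis by (rule AE_I')
qed

lemma AE_norm_le_if_rad_less:
  assumes "sets \<mu> = sets borel" "rad \<mu> < ennreal R"
  shows "AE x in \<mu>. norm x \<le> R"
proof -
  obtain R' where R': "msupport \<mu> \<subseteq> ball 0 R'" "ennreal R' < ennreal R"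
    using assms(2) by (auto simp: rad_def INF_less_iff)
  then have "R' < R" by (metis ennreal_leI linorder_not_le)
  show ?thesis
    using AE_in_msupport[OF assms(1)] by eventually_elim (use R' \<open>R' < R\<close> in force)
qed

lemma moment_le_if_moment_scale_less:
  assumes "0 < q" "0 < R" "moment_scale (ereal q) \<mu> < ennreal R"
  shows "moment q \<mu> \<le> ennreal (R powr q)"
proof -
  obtain m where m: "moment q \<mu> = ennreal m" "0 \<le> m"
    using assms(3) by (cases "moment q \<mu>") (auto simp: moment_scale_def ennpow_def)
  then have "m powr (1 / q) < R"
    using assms(3) by (simp add: moment_scale_def ennpow_ennreal ennreal_less_iff)
  then have "(m powr (1 / q)) powr q \<le> R powr q" using assms by (intro powr_mono2) auto
  then show ?thesis using m assms by (simp add: powr_powr ennreal_leI)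
qed

lemma moment_scale_finite:
  assumes "\<mu> \<in> probs_moment q"
  shows "moment_scale q \<mu> < \<infinity>"
  using assms by (cases "q = \<infinity>") (auto simp: probs_moment_def moment_scale_def ennpow_def)

text \<open>A point of norm \<open>R\<close> has a time of size at most \<open>C * R ^ d\<close>.
  Division by this number brings the \<sigma>-th moment of \<open>G\<close>, or for infinite
  \<open>q\<close> its essential bound, below 1.\<close>

lemma normalized_quantile_cost_bound:
  assumes pq: "0 < p" "ereal p < q" and "0 < d" "0 < C"
  shows "\<exists>K>0. \<forall>(\<mu> :: 'a::euclidean_space measure) N R G.
    \<mu> \<in> probs_moment q \<longrightarrow> 1 \<le> N \<longrightarrow> 0 < R \<longrightarrow> moment_scale q \<mu> < ennreal R \<longrightarrow>
    quantile_function G \<longrightarrow>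
    (\<forall>\<sigma>>0. (\<integral>\<^sup>+u. ennreal (\<bar>G u\<bar> powr \<sigma>) \<partial>uniform01) \<le> ennreal (C powr \<sigma>) * moment (real d * \<sigma>) \<mu>) \<longrightarrow>
    (\<forall>R. (AE x in \<mu>. norm x \<le> R) \<longrightarrow> (AE u in uniform01. \<bar>G u\<bar> \<le> C * R ^ d)) \<longrightarrow>
    quantile_cost (\<lambda>u. G u / (C * R ^ d)) N (p / d) \<le> ennreal (K * rate1 (p / d) (p * inv_exp q) N)"
proof (cases q)
  case (real q')
  define \<sigma> where "\<sigma> = q' / d"
  have q': "p < q'" using pq real by simp
  have r: "0 < p / d" "p / d < \<sigma>" "p / d / \<sigma> = p * inv_exp q"
    using assms q' real by (auto simp: \<sigma>_def inv_exp_def divide_strict_right_mono)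
  have s: "0 < \<sigma>" "d * \<sigma> = q'" using assms q' by (auto simp: \<sigma>_def)
  obtain K where K: "0 < K"
    "\<And>G N. quantile_function G \<Longrightarrow> (\<integral>\<^sup>+u. ennreal (\<bar>G u\<bar> powr \<sigma>) \<partial>uniform01) \<le> 1 \<Longrightarrow> 1 \<le> N \<Longrightarrow>
      quantile_cost G N (p / d) \<le> ennreal (K * rate1 (p / d) (p * inv_exp q) N)"
    using quantile_cost_bound[OF r(1,2)] unfolding r(3) by blast
  show ?thesis
  proof (intro exI[of _ K] conjI K(1) allI impI K(2))
    fix \<mu> :: "'a measure" and R and G :: "real \<Rightarrow> real"
    assume R: "0 < R" "moment_scale q \<mu> < ennreal R" and "quantile_function G"
      and G: "\<forall>\<sigma>>0. (\<integral>\<^sup>+u. ennreal (\<bar>G u\<bar> powr \<sigma>) \<partial>uniform01) \<le> ennreal (C powr \<sigma>) * moment (real d * \<sigma>) \<mu>"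
    interpret quantile_function G by fact
    define \<rho> where "\<rho> = C * R ^ d"
    have \<rho>: "0 < \<rho>" using assms R by (simp add: \<rho>_def)
    show "quantile_function (\<lambda>u. G u / (C * R ^ d))"
      using quantile_function_divide[OF \<rho>] by (simp add: \<rho>_def)
    have "(\<integral>\<^sup>+u. ennreal (\<bar>G u / \<rho>\<bar> powr \<sigma>) \<partial>uniform01)
        = (\<integral>\<^sup>+u. ennreal (1 / \<rho> powr \<sigma>) * ennreal (\<bar>G u\<bar> powr \<sigma>) \<partial>uniform01)"
      using \<rho> by (intro nn_integral_cong) (simp add: powr_divide flip: ennreal_mult')
    also have "\<dots> = ennreal (1 / \<rho> powr \<sigma>) * (\<integral>\<^sup>+u. ennreal (\<bar>G u\<bar> powr \<sigma>) \<partial>uniform01)"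
      by (rule nn_integral_cmult) measurable
    also have "\<dots> \<le> ennreal (1 / \<rho> powr \<sigma>) * (ennreal (C powr \<sigma>) * ennreal (R powr q'))"
    proof (intro mult_left_mono)
      have "(\<integral>\<^sup>+u. ennreal (\<bar>G u\<bar> powr \<sigma>) \<partial>uniform01) \<le> ennreal (C powr \<sigma>) * moment q' \<mu>"
        using G s by metis
      also have "\<dots> \<le> ennreal (C powr \<sigma>) * ennreal (R powr q')"
        using R pq q' unfolding real by (intro mult_left_mono moment_le_if_moment_scale_less) auto
      finally show "(\<integral>\<^sup>+u. ennreal (\<bar>G u\<bar> powr \<sigma>) \<partial>uniform01) \<le> ennreal (C powr \<sigma>) * ennreal (R powr q')" .
    qed simp
    also have "\<dots> = ennreal (1 / \<rho> powr \<sigma> * (C powr \<sigma> * R powr q'))"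
      using ennreal_mult[of "1 / \<rho> powr \<sigma>" "C powr \<sigma> * R powr q'"] ennreal_mult[of "C powr \<sigma>" "R powr q'"]
      by simp
    also have "C powr \<sigma> * R powr q' = \<rho> powr \<sigma>"
      using R s by (simp add: \<rho>_def powr_mult powr_powr flip: powr_realpow)
    finally show "(\<integral>\<^sup>+u. ennreal (\<bar>G u / (C * R ^ d)\<bar> powr \<sigma>) \<partial>uniform01) \<le> 1"
      using \<rho> unfolding \<rho>_def[symmetric] by simp
  qed
next
  case PInf
  have "0 < p / d" using assms by simp
  from bounded_quantile_cost_bound[OF this]
  obtain K where K: "0 < K" "\<forall>G N. quantile_function G \<longrightarrow> (AE u in uniform01. \<bar>G u\<bar> \<le> 1) \<longrightarrow> 1 \<le> N \<longrightarrow>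
      quantile_cost G N (p / d) \<le> ennreal (K * rate1 (p / d) 0 N)"
    by (elim exE conjE) (rule that)
  have 0: "p * inv_exp q = 0" using PInf by (simp add: inv_exp_def)
  show ?thesis
    unfolding 0
  proof (intro exI[of _ K] conjI K(1) allI impI K(2)[rule_format])
    fix \<mu> :: "'a measure" and R and G :: "real \<Rightarrow> real"
    assume \<mu>: "\<mu> \<in> probs_moment q" and R: "0 < R" "moment_scale q \<mu> < ennreal R" and "quantile_function G"
      and G: "\<forall>R. (AE x in \<mu>. norm x \<le> R) \<longrightarrow> (AE u in uniform01. \<bar>G u\<bar> \<le> C * R ^ d)"
    interpret quantile_function G by fact
    have \<rho>: "0 < C * R ^ d" using assms R by simp
    show "quantile_function (\<lambda>u. G u / (C * R ^ d))" by (rule quantile_function_divide[OF \<rho>])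
    have "AE x in \<mu>. norm x \<le> R"
      using R \<mu> PInf by (intro AE_norm_le_if_rad_less) (auto simp: moment_scale_def probs_moment_def borel_probs_def)
    then have "AE u in uniform01. \<bar>G u\<bar> \<le> C * R ^ d" using G by blast
    then show "AE u in uniform01. \<bar>G u / (C * R ^ d)\<bar> \<le> 1"
      by eventually_elim (use \<rho> in \<open>simp add: abs_divide\<close>)
  qed
qed (use pq in auto)

lemma quant_error_upper_bound:
  fixes p :: real and q :: ereal
  assumes pq: "0 < p" "ereal p < q"
  shows "\<exists>C::real. C > 0 \<and> (\<forall>N::nat. N \<ge> 1 \<longrightarrow> (\<forall>\<mu> :: (real ^ 'n::finite) measure. \<mu> \<in> probs_moment q \<longrightarrow>
    quant_error N p \<mu> \<le> ennreal C * moment_scale q \<mu> * ennreal (rate CARD('n) p q N)))"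
proof -
  define d where "d = CARD('n)"
  have d: "0 < d" by (simp add: d_def)
  obtain h :: "real \<Rightarrow> real ^ 'n" and C where C: "0 < C" and cont: "continuous_on UNIV h"
    and h: "\<And>x y. norm (h x - h y) \<le> C * \<bar>x - y\<bar> powr (1 / d)"
    and repr: "\<And>\<mu>. \<mu> \<in> borel_probs \<Longrightarrow> \<exists>G. quantile_function G \<and> distr uniform01 borel (h \<circ> G) = \<mu> \<and>
      (\<forall>\<sigma>>0. (\<integral>\<^sup>+u. ennreal (\<bar>G u\<bar> powr \<sigma>) \<partial>uniform01) \<le> ennreal (C powr \<sigma>) * moment (real d * \<sigma>) \<mu>) \<and>
      (\<forall>R. (AE x in \<mu>. norm x \<le> R) \<longrightarrow> (AE u in uniform01. \<bar>G u\<bar> \<le> C * R ^ d))"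
    by (rule curve_representation[where 'n='n, folded d_def], rule that)
  define r where "r = 1 / d * p"
  have r: "0 < r" "r = p / d" using pq d by (simp_all add: r_def)
  obtain K where K: "0 < K" and cost: "\<And>(\<mu> :: (real ^ 'n) measure) N R G. \<mu> \<in> probs_moment q \<Longrightarrow> 1 \<le> N \<Longrightarrow> 0 < R \<Longrightarrow>
      moment_scale q \<mu> < ennreal R \<Longrightarrow> quantile_function G \<Longrightarrow>
      (\<forall>\<sigma>>0. (\<integral>\<^sup>+u. ennreal (\<bar>G u\<bar> powr \<sigma>) \<partial>uniform01) \<le> ennreal (C powr \<sigma>) * moment (real d * \<sigma>) \<mu>) \<Longrightarrow>
      (\<forall>R. (AE x in \<mu>. norm x \<le> R) \<longrightarrow> (AE u in uniform01. \<bar>G u\<bar> \<le> C * R ^ d)) \<Longrightarrow>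
      quantile_cost (\<lambda>u. G u / (C * R ^ d)) N r \<le> ennreal (K * rate1 r (p * inv_exp q) N)"
    using normalized_quantile_cost_bound[OF pq d C, folded r(2)] by blast
  \<comment> \<open>The factors are the Hoelder constant, the d-th root of the \<open>C\<close> in
    \<open>C * R ^ d\<close>, and the constant of the cost bound.\<close>
  define A where "A = C * C powr (1 / d) * K powr (1 / p)"
  have A: "0 < A" using C K by (simp add: A_def)
  show ?thesis
  proof (intro exI[of _ A] conjI A allI impI)
    fix N :: nat and \<mu> :: "(real ^ 'n) measure"
    assume N: "N \<ge> 1" and \<mu>: "\<mu> \<in> probs_moment q"
    obtain G where "quantile_function G" and G: "distr uniform01 borel (h \<circ> G) = \<mu>"
      "\<forall>\<sigma>>0. (\<integral>\<^sup>+u. ennreal (\<bar>G u\<bar> powr \<sigma>) \<partial>uniform01) \<le> ennreal (C powr \<sigma>) * moment (real d * \<sigma>) \<mu>"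
      "\<forall>R. (AE x in \<mu>. norm x \<le> R) \<longrightarrow> (AE u in uniform01. \<bar>G u\<bar> \<le> C * R ^ d)"
      using repr[of \<mu>] \<mu> by (auto simp: probs_moment_def)
    interpret quantile_function G by fact
    define B where "B = rate1 r (p * inv_exp q) N"
    have B: "0 < B" using rate1_pos N by (simp add: B_def)
    have rate: "rate d p q N = B powr (1 / p)"
      unfolding B_def r(2) using pq d N by (intro rate_eq_rate1)
    show "quant_error N p \<mu> \<le> ennreal A * moment_scale q \<mu> * ennreal (rate CARD('n) p q N)"
    proof (rule le_mult_ennreal_if_le_mult_greater[OF moment_scale_finite[OF \<mu>] A])
      show "0 < rate CARD('n) p q N" using rate B by (simp flip: d_def)
      fix R :: real assume R: "0 < R" "moment_scale q \<mu> < ennreal R"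
      define \<rho> where "\<rho> = C * R ^ d"
      have \<rho>: "0 < \<rho>" using C R by (simp add: \<rho>_def)
      have "quant_error N p \<mu> \<le> ennreal (C * \<rho> powr (1 / d) * (K * B) powr (1 / p))"
        unfolding G(1)[symmetric]
      proof (rule quant_error_rescaled_le[OF h cont])
        show "quantile_cost (\<lambda>u. G u / \<rho>) N (1 / d * p) \<le> ennreal (K * B)"
          unfolding \<rho>_def B_def r_def[symmetric]
          using cost[OF \<mu> N R \<open>quantile_function G\<close> G(2,3)] .
      qed (use C d pq N \<rho> K B in auto)
      also have "\<rho> powr (1 / d) = C powr (1 / d) * R"
        using C R d by (simp add: \<rho>_def powr_mult powr_powr flip: powr_realpow)
      also have "C * (C powr (1 / d) * R) * (K * B) powr (1 / p) = A * R * rate CARD('n) p q N"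
        using rate by (simp add: A_def powr_mult flip: d_def)
      finally show "quant_error N p \<mu> \<le> ennreal (A * R * rate CARD('n) p q N)" .
    qed
  qed
qed

section \<open>The limit in the subcritical case\<close>

context quantile_function
begin

text \<open>Every fixed \<open>u\<close> leaves both end cells once 1/N is smaller than u and 1 - u;
  the rest is dominated convergence.\<close>

lemma end_cells_integral_tendsto_0:
  assumes [measurable]: "f \<in> borel_measurable uniform01" and "(\<integral>\<^sup>+u. f u \<partial>uniform01) < \<infinity>"
  shows "(\<lambda>N. \<integral>\<^sup>+u\<in>cells N {1, N}. f u \<partial>uniform01) \<longlonglongrightarrow> 0"
proof -
  have "(\<lambda>N. \<integral>\<^sup>+u\<in>cells N {1, N}. f u \<partial>uniform01) \<longlonglongrightarrow> (\<integral>\<^sup>+u. 0 \<partial>uniform01)"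
  proof (rule nn_integral_dominated_convergence[where w = f])
    show "AE u in uniform01. (\<lambda>N. f u * indicator (cells N {1, N}) u) \<longlonglongrightarrow> 0"
    proof (rule AE_I2)
      fix u assume "u \<in> space uniform01"
      then have u: "0 < u" "u < 1" by (auto simp: space_uniform01)
      have "eventually (\<lambda>N. 1 / real N < u) sequentially" "eventually (\<lambda>N. 1 / real N < 1 - u) sequentially"
        using u by real_asymp+
      then have "eventually (\<lambda>N. f u * indicator (cells N {1, N}) u = 0) sequentially"
        using eventually_gt_at_top[of 0]
      proof eventually_elim
        case (elim N)
        then have "1 \<le> N" by simp
        then have "cell N u \<noteq> 1" "cell N u \<noteq> N"
          using elim cell_eq_iff[of N 1 u] cell_eq_iff[of N N u] by (auto simp: diff_divide_distrib)
        then show ?case by (simp add: cells_def)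
      qed
      then show "(\<lambda>N. f u * indicator (cells N {1, N}) u) \<longlonglongrightarrow> 0"
        by (rule tendsto_eventually)
    qed
    show "AE u in uniform01. f u * indicator (cells N {1, N}) u \<le> f u" for N
      by (auto simp: indicator_def)
  qed (use assms in auto)
  then show ?thesis by simp
qed

text \<open>The estimates of the upper bound are repeated with the actual end cell moment, which
  tends to 0. The assumption on the exponents means a < 1 when r < 1, so that \<kappa> enters with a
  positive power.\<close>

lemma quantile_cost_little_o:
  assumes "0 < r" "r < \<sigma>" "1 < r + r / \<sigma>" and total: "(\<integral>\<^sup>+u. ennreal (\<bar>G u\<bar> powr \<sigma>) \<partial>uniform01) < \<infinity>"
  shows "\<exists>Z. Z \<longlonglongrightarrow> 0 \<and> (\<forall>N. 0 \<le> Z N) \<and> (\<forall>N\<ge>1. quantile_cost G N r \<le> ennreal (N powr (r / \<sigma> - 1) * Z N))"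
proof -
  have s: "0 < \<sigma>" using assms by simp
  obtain M where M: "(\<integral>\<^sup>+u. ennreal (\<bar>G u\<bar> powr \<sigma>) \<partial>uniform01) = ennreal M" "0 \<le> M"
    using total by (cases "\<integral>\<^sup>+u. ennreal (\<bar>G u\<bar> powr \<sigma>) \<partial>uniform01") auto
  define \<tau> where "\<tau> N = (\<integral>\<^sup>+u\<in>cells N {1, N}. ennreal (\<bar>G u\<bar> powr \<sigma>) \<partial>uniform01)" for N
  have \<tau>_le: "\<tau> N \<le> ennreal M" for N
    unfolding \<tau>_def M(1)[symmetric] by (intro nn_integral_mono) (auto simp: indicator_def)
  \<comment> \<open>The summand 1/N keeps \<kappa> positive, as the estimates require, even if the
    end cells carry no moment.\<close>
  define \<kappa> where "\<kappa> N = enn2real (\<tau> N) + 1 / N" for N :: nat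
  have \<tau>_0: "\<tau> \<longlonglongrightarrow> 0"
    unfolding \<tau>_def by (rule end_cells_integral_tendsto_0) (use total in auto)
  have "(\<lambda>N. enn2real (\<tau> N)) \<longlonglongrightarrow> 0"
    by (rule tendsto_enn2real) (use \<tau>_0 in simp_all)
  then have \<kappa>_0: "\<kappa> \<longlonglongrightarrow> 0"
    unfolding \<kappa>_def using lim_1_over_n[where 'a=real] by (auto intro: tendsto_add_zero)
  have \<kappa>_nonneg: "0 \<le> \<kappa> N" for N by (simp add: \<kappa>_def)
  have \<kappa>_pos: "0 < \<kappa> N" if "1 \<le> N" for N
    using that by (simp add: \<kappa>_def add_nonneg_pos)
  have tail: "\<tau> N \<le> ennreal (\<kappa> N)" for N
  proof -
    have "\<tau> N < \<infinity>" using \<tau>_le[of N] by (simp add: le_less_trans)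
    then have "\<tau> N = ennreal (enn2real (\<tau> N))" by simp
    also have "\<dots> \<le> ennreal (\<kappa> N)" by (intro ennreal_leI) (simp add: \<kappa>_def)
    finally show ?thesis .
  qed
  have \<kappa>_powr: "(\<lambda>N. \<kappa> N powr a) \<longlonglongrightarrow> 0" if "0 < a" for a
    using tendsto_powr'[OF \<kappa>_0 tendsto_const, of a] that \<kappa>_nonneg by simp
  have "\<exists>Z. Z \<longlonglongrightarrow> 0 \<and> (\<forall>N. 0 \<le> Z N) \<and>
      (\<forall>N\<ge>1. (\<Sum>i=2..N-1. (t N i - t N (i - 1)) powr r) / N \<le> N powr (r / \<sigma> - 1) * Z N)"
  proof (cases "1 \<le> r")
    case True
    have "(\<lambda>N. 2 powr r * \<kappa> N powr (r / \<sigma>)) \<longlonglongrightarrow> 2 powr r * 0"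
      using assms s by (intro tendsto_mult_left \<kappa>_powr) auto
    moreover have "(\<Sum>i=2..N-1. (t N i - t N (i - 1)) powr r) / N \<le> N powr (r / \<sigma> - 1) * (2 powr r * \<kappa> N powr (r / \<sigma>))"
      if "1 \<le> N" for N
      using increments_cost_ge1[OF that True s \<kappa>_pos[OF that] tail[unfolded \<tau>_def]] by (simp add: mult_ac)
    ultimately show ?thesis by (intro exI[of _ "\<lambda>N. 2 powr r * \<kappa> N powr (r / \<sigma>)"]) auto
  next
    case False
    then have r: "r < 1" by simp
    define a where "a = \<sigma> * (1 - r) / r"
    have a: "a < 1" using assms s by (simp add: a_def field_simps)
    define D where "D = (2 powr \<sigma> * (1 + 4 * M)) powr (1 - r)"
    define Z where "Z N = D * ((2 / (1 - a)) powr r * (N powr (- 1 / \<sigma>) + \<kappa> N powr (1 / \<sigma>)) powr ((1 - a) * r))" for N :: nat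
    have "(\<lambda>N. real N powr (- 1 / \<sigma>)) \<longlonglongrightarrow> 0"
      using s by real_asymp
    then have "(\<lambda>N. real N powr (- 1 / \<sigma>) + \<kappa> N powr (1 / \<sigma>)) \<longlonglongrightarrow> 0"
      using s by (intro tendsto_add_zero \<kappa>_powr) auto
    then have "(\<lambda>N. (real N powr (- 1 / \<sigma>) + \<kappa> N powr (1 / \<sigma>)) powr ((1 - a) * r)) \<longlonglongrightarrow> 0 powr ((1 - a) * r)"
      using a assms by (intro tendsto_powr' tendsto_const) auto
    then have "(\<lambda>N. (real N powr (- 1 / \<sigma>) + \<kappa> N powr (1 / \<sigma>)) powr ((1 - a) * r)) \<longlonglongrightarrow> 0" by simp
    then have "Z \<longlonglongrightarrow> D * ((2 / (1 - a)) powr r * 0)"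
      unfolding Z_def by (intro tendsto_mult_left)
    moreover have "(\<Sum>i=2..N-1. (t N i - t N (i - 1)) powr r) / N \<le> N powr (r / \<sigma> - 1) * Z N" if "1 \<le> N" for N
    proof -
      have "(\<Sum>i=2..N-1. (t N i - t N (i - 1)) powr r) / N
          \<le> D * (N powr (- r) * (2 * Phi a ((N * \<kappa> N) powr (1 / \<sigma>))) powr r)"
        unfolding D_def a_def
        using that assms s r M \<kappa>_pos[OF that] tail[of N] by (intro increments_cost_lt1) (auto simp: \<tau>_def)
      also have "\<dots> \<le> D * (N powr (r / \<sigma> - 1) *
          ((2 / (1 - a)) powr r * (N powr (- 1 / \<sigma>) + \<kappa> N powr (1 / \<sigma>)) powr ((1 - a) * r)))"
        using Phi_subcritical_bound[OF assms(1) r s _ _ \<kappa>_nonneg[of N], of "real N"] a that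
        by (intro mult_left_mono) (auto simp: D_def a_def)
      finally show ?thesis by (simp only: Z_def mult_ac)
    qed
    moreover have "0 \<le> Z N" for N by (simp add: Z_def D_def)
    ultimately show ?thesis by (intro exI[of _ Z]) simp
  qed
  then obtain Z where Z: "Z \<longlonglongrightarrow> 0" "\<And>N. 0 \<le> Z N"
    "\<And>N. 1 \<le> N \<Longrightarrow> (\<Sum>i=2..N-1. (t N i - t N (i - 1)) powr r) / N \<le> N powr (r / \<sigma> - 1) * Z N" by blast
  show ?thesis
  proof (intro exI[of _ "\<lambda>N. Z N + 3 * \<kappa> N powr (r / \<sigma>)"] conjI allI impI)
    have "(\<lambda>N. Z N + 3 * \<kappa> N powr (r / \<sigma>)) \<longlonglongrightarrow> 0 + 3 * 0"
      using assms s by (intro tendsto_add Z(1) tendsto_mult_left \<kappa>_powr) auto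
    then show "(\<lambda>N. Z N + 3 * \<kappa> N powr (r / \<sigma>)) \<longlonglongrightarrow> 0" by simp
    show "0 \<le> Z N + 3 * \<kappa> N powr (r / \<sigma>)" for N using Z(2) by simp
    fix N :: nat assume N: "1 \<le> N"
    have "quantile_cost G N r \<le> ennreal (N powr (r / \<sigma> - 1) * Z N) + ennreal (3 * (N powr (r / \<sigma> - 1) * \<kappa> N powr (r / \<sigma>)))"
      unfolding quantile_cost_eq using Z(3)[OF N] tail_powr_le[OF N assms(1,2) \<kappa>_pos[OF N] tail[unfolded \<tau>_def]]
      by (intro add_mono ennreal_leI)
    also have "\<dots> = ennreal (N powr (r / \<sigma> - 1) * (Z N + 3 * \<kappa> N powr (r / \<sigma>)))"
      using Z(2) by (subst ennreal_plus[symmetric]) (auto simp: algebra_simps)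
    finally show "quantile_cost G N r \<le> ennreal (N powr (r / \<sigma> - 1) * (Z N + 3 * \<kappa> N powr (r / \<sigma>)))" .
  qed
qed

end

lemma quant_error_little_o:
  fixes p :: real and q :: ereal and \<mu> :: "(real ^ 'n::finite) measure"
  assumes pq: "0 < p" "ereal p < q" "q < \<infinity>" and crit: "real CARD('n) < crit_dim p q"
    and \<mu>: "\<mu> \<in> probs_moment q"
  shows "(\<lambda>N. ennreal (real N powr (1 / p - inv_exp q)) * quant_error N p \<mu>) \<longlonglongrightarrow> 0"
proof -
  define d where "d = CARD('n)"
  have d: "0 < d" by (simp add: d_def)
  obtain q' where q': "q = ereal q'" "p < q'" using pq by (cases q) auto
  obtain h :: "real \<Rightarrow> real ^ 'n" and C where C: "0 < C" and cont: "continuous_on UNIV h"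
    and h: "\<And>x y. norm (h x - h y) \<le> C * \<bar>x - y\<bar> powr (1 / d)"
    and repr: "\<And>\<mu>. \<mu> \<in> borel_probs \<Longrightarrow> \<exists>G. quantile_function G \<and> distr uniform01 borel (h \<circ> G) = \<mu> \<and>
      (\<forall>\<sigma>>0. (\<integral>\<^sup>+u. ennreal (\<bar>G u\<bar> powr \<sigma>) \<partial>uniform01) \<le> ennreal (C powr \<sigma>) * moment (real d * \<sigma>) \<mu>) \<and>
      (\<forall>R. (AE x in \<mu>. norm x \<le> R) \<longrightarrow> (AE u in uniform01. \<bar>G u\<bar> \<le> C * R ^ d))"
    by (rule curve_representation[where 'n='n, folded d_def], rule that)
  obtain G where "quantile_function G" and G: "distr uniform01 borel (h \<circ> G) = \<mu>"
    "\<forall>\<sigma>>0. (\<integral>\<^sup>+u. ennreal (\<bar>G u\<bar> powr \<sigma>) \<partial>uniform01) \<le> ennreal (C powr \<sigma>) * moment (real d * \<sigma>) \<mu>"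
    using repr[of \<mu>] \<mu> by (auto simp: probs_moment_def)
  interpret quantile_function G by fact
  define r \<sigma> where "r = 1 / d * p" and "\<sigma> = q' / d"
  have r: "0 < r" "r < \<sigma>" "0 < \<sigma>" "r / \<sigma> = p / q'" "real d * \<sigma> = q'"
    using pq q' d by (auto simp: r_def \<sigma>_def divide_strict_right_mono)
  \<comment> \<open>This is p/d + p/q > 1, another form of d < pq/(q-p).\<close>
  have "1 < r + r / \<sigma>"
  proof -
    have "real d * (q' - p) < p * q'"
      using crit q' by (simp add: crit_dim_def d_def[symmetric] pos_less_divide_eq)
    then show ?thesis unfolding r(4) using d pq q' by (simp add: r_def field_simps)
  qed
  moreover have "(\<integral>\<^sup>+u. ennreal (\<bar>G u\<bar> powr \<sigma>) \<partial>uniform01) < \<infinity>"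
  proof -
    have "(\<integral>\<^sup>+u. ennreal (\<bar>G u\<bar> powr \<sigma>) \<partial>uniform01) \<le> ennreal (C powr \<sigma>) * moment q' \<mu>"
      using G(2) r by metis
    also have "\<dots> < \<infinity>" using \<mu> q' by (simp add: probs_moment_def ennreal_mult_less_top)
    finally show ?thesis .
  qed
  ultimately obtain Z where Z: "Z \<longlonglongrightarrow> 0" "\<And>N. 0 \<le> Z N"
    "\<And>N. 1 \<le> N \<Longrightarrow> quantile_cost G N r \<le> ennreal (N powr (r / \<sigma> - 1) * Z N)"
    using quantile_cost_little_o[OF r(1,2)] by blast
  have "(\<lambda>N. C * Z N powr (1 / p)) \<longlonglongrightarrow> C * 0 powr (1 / p)"
    using pq Z(2) by (intro tendsto_mult_left tendsto_powr' Z(1) tendsto_const) auto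
  then have lim: "(\<lambda>N. ennreal (C * Z N powr (1 / p))) \<longlonglongrightarrow> 0"
    using tendsto_ennrealI by fastforce
  have bound: "ennreal (real N powr (1 / p - inv_exp q)) * quant_error N p \<mu> \<le> ennreal (C * Z N powr (1 / p))"
    if N: "1 \<le> N" for N
  proof -
    have "quant_error N p \<mu> \<le> ennreal (C * 1 powr (1 / d) * (N powr (r / \<sigma> - 1) * Z N) powr (1 / p))"
      unfolding G(1)[symmetric]
    proof (rule quant_error_rescaled_le[OF h cont])
      show "quantile_cost (\<lambda>u. G u / 1) N (1 / d * p) \<le> ennreal (N powr (r / \<sigma> - 1) * Z N)"
        using Z(3)[OF N] by (simp add: r_def)
    qed (use C d pq N Z(2) in auto)
    then have "ennreal (real N powr (1 / p - inv_exp q)) * quant_error N p \<mu>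
        \<le> ennreal (real N powr (1 / p - inv_exp q)) * ennreal (C * 1 powr (1 / d) * (N powr (r / \<sigma> - 1) * Z N) powr (1 / p))"
      by (rule mult_left_mono) simp
    also have "\<dots> = ennreal (C * (N powr (1 / p - inv_exp q) * N powr ((r / \<sigma> - 1) / p)) * Z N powr (1 / p))"
      using C by (subst ennreal_mult[symmetric]) (auto simp: powr_mult powr_powr mult_ac)
    also have "N powr (1 / p - inv_exp q) * N powr ((r / \<sigma> - 1) / p) = 1"
    proof -
      have "1 / p - inv_exp q + (r / \<sigma> - 1) / p = 0"
        unfolding r(4) using q' pq by (simp add: inv_exp_def diff_divide_distrib)
      then show ?thesis using N by (simp flip: powr_add)
    qed
    finally show ?thesis by simp
  qed
  show ?thesis
  proof (rule tendsto_sandwich[OF _ _ tendsto_const lim])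
    show "\<forall>\<^sub>F N in sequentially. ennreal (real N powr (1 / p - inv_exp q)) * quant_error N p \<mu>
        \<le> ennreal (C * Z N powr (1 / p))"
      using eventually_ge_at_top[of 1] by eventually_elim (rule bound)
  qed simp
qed

theorem theorem1p1:
  fixes p :: real and q :: ereal
  assumes "0 < p" and "ereal p < q"
  shows "(\<exists>C::real. C > 0 \<and>
            (\<forall>N::nat. N \<ge> 1 \<longrightarrow> (\<forall>\<mu> :: (real ^ 'n::finite) measure. \<mu> \<in> probs_moment q \<longrightarrow>
               quant_error N p \<mu> \<le> ennreal C * moment_scale q \<mu> * ennreal (rate CARD('n) p q N))))
       \<and> (q < \<infinity> \<and> real CARD('n) < crit_dim p q \<longrightarrow>
            (\<forall>\<mu> :: (real ^ 'n::finite) measure. \<mu> \<in> probs_moment q \<longrightarrow>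
               (\<lambda>N. ennreal (real N powr (1 / p - inv_exp q)) * quant_error N p \<mu>)
                 \<longlonglongrightarrow> 0))"
  using quant_error_upper_bound[OF assms] quant_error_little_o[OF assms] by blast

end
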